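(* Let $m \ge 20$, $n = \binom{m}{2}$, and let $d:\{0,1\}^n\to\mathbb{R}$ be the density function of the uniform distribution over those $x\in\{0,1\}^n$ for which the graph $G_x$ is a spanning tree of the complete graph $K_m$. Suppose that $d$ can be approximated arbitrarily well by D&C SPNs of size $\le s$, i.e. there is a sequence $(\Phi_j)_{j\ge1}$ of D&C SPNs over $x\in\{0,1\}^n$, each of size at most $s$ (where the univariate functions $f$ are allowed to be different for each $\Phi_j$), whose output functions $q_{\Phi_j}(f(x))$ converge to $d(x)$ for every $x\in\{0,1\}^n$ as $j\to\infty$. Then $s \ge 2^{m/30240}$.
   Context: Graph encoding: the edges of $K_m$ are labeled by $1,\dots,n$ with $n=\binom m2$; for $x\in\{0,1\}^n$, $G_x$ is the subgraph of $K_m$ on all $m$ vertices containing exactly the edges $i$ with $x_i=1$. Thus $d(x)=1/m^{m-2}$ if $G_x$ is a spanning tree of $K_m$, and $d(x)=0$ otherwise. Arithmetic circuits: an arithmetic circuit $\Phi$ over a tuple of variables $y$ is a finite directed acyclic graph with a unique node of out-degree $0$ (the root). Each node of in-degree $0$ is labeled by a variable of $y$ or a real constant; every other node is labeled $\times$ (product node) or $+$ (sum node), and edges into sum nodes carry real weights. The children $C(u)$ of $u$ are the nodes with an edge into $u$. Labeled leaves compute their labels, a product node computes $q_u=\prod_{v\in C(u)}q_v$, a sum node computes $q_u=\sum_{v\in C(u)}w_{v,u}q_v$; $q_\Phi$ is the polynomial computed by the root. $\Phi$ is monotone if all weights and constants are non-negative. The size is the number of nodes (there is no restriction on depth). SPNs: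 let $x=(x_1,\dots,x_n)$, $x_i\in R_i\subseteq\mathbb{R}$ with measures $M_i$ on $R_i$ (here $R_i=\{0,1\}$ with counting measure), and let $f$ be a tuple of non-negative univariate functions $f_{i,j}(x_i)$, each with finite $M_i$-integral. A Sum Product Network (SPN) is a monotone arithmetic circuit over $f$ (the $f_{i,j}$ being the variables); it computes the function $x\mapsto q_\Phi(f(x))$. The dependency-scope of a node $u$ is the set of those $x_i$ such that some $f_{i,j}$ labels a node in the sub-circuit rooted at $u$. An SPN is decomposable if for every product node the dependency-scopes of its children are pairwise disjoint, complete if for every sum node the dependency-scopes of its children are all equal, and a D&C SPN if it is both. *)

theory Defs
  imports "HOL-Probability.Probability" "Graph_Theory.Graph_Theory"
begin

section \<open>Arithmetic circuits\<close>

datatype 'v node_label = Var 'v | Const real | Product_Node | Sum_Node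

text \<open>An arc \<open>(v, u)\<close> of the graph says that \<open>v\<close> is a child of \<open>u\<close>. The
  weight of an arc is only used if its target is a sum node.\<close>

record ('a, 'v) circuit =
  dag :: "'a pair_pre_digraph"
  label :: "'a \<Rightarrow> 'v node_label"
  weight :: "'a \<times> 'a \<Rightarrow> real"

definition nodes :: "('a, 'v) circuit \<Rightarrow> 'a set" where
  "nodes \<Phi> = pverts (dag \<Phi>)"

definition children :: "('a, 'v) circuit \<Rightarrow> 'a \<Rightarrow> 'a set" where
  "children \<Phi> u = {v. (v, u) \<in> parcs (dag \<Phi>)}"

definition is_root :: "('a, 'v) circuit \<Rightarrow> 'a \<Rightarrow> bool" where
  "is_root \<Phi> r \<longleftrightarrow> r \<in> nodes \<Phi> \<and> out_degree (with_proj (dag \<Phi>)) r = 0"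

definition arithmetic_circuit :: "'v set \<Rightarrow> ('a, 'v) circuit \<Rightarrow> bool" where
  "arithmetic_circuit V \<Phi> \<longleftrightarrow>
     pair_fin_digraph (dag \<Phi>) \<and> acyclic (parcs (dag \<Phi>)) \<and> (\<exists>!r. is_root \<Phi> r) \<and>
     (\<forall>u\<in>nodes \<Phi>.
        if in_degree (with_proj (dag \<Phi>)) u = 0
        then (\<exists>v\<in>V. label \<Phi> u = Var v) \<or> (\<exists>c. label \<Phi> u = Const c)
        else label \<Phi> u \<in> {Product_Node, Sum_Node})"

definition root :: "('a, 'v) circuit \<Rightarrow> 'a" where
  "root \<Phi> = (THE r. is_root \<Phi> r)"

definition circuit_size :: "('a, 'v) circuit \<Rightarrow> nat" where
  "circuit_size \<Phi> = card (nodes \<Phi>)"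

definition monotone_circuit :: "('a, 'v) circuit \<Rightarrow> bool" where
  "monotone_circuit \<Phi> \<longleftrightarrow>
     (\<forall>u\<in>nodes \<Phi>. \<forall>c. label \<Phi> u = Const c \<longrightarrow> 0 \<le> c) \<and>
     (\<forall>u\<in>nodes \<Phi>. label \<Phi> u = Sum_Node \<longrightarrow> (\<forall>v\<in>children \<Phi> u. 0 \<le> weight \<Phi> (v, u)))"

text \<open>\<open>node_value \<Phi> y u\<close> is the value at \<open>y\<close> of the polynomial computed by node
  \<open>u\<close>, by well-founded recursion along the arcs; the intended recursion equation is
  lemma \<open>node_value_eq\<close>.\<close>

definition node_value :: "('a, 'v) circuit \<Rightarrow> ('v \<Rightarrow> real) \<Rightarrow> 'a \<Rightarrow> real" where
  "node_value \<Phi> y = wfrec (parcs (dag \<Phi>)) (\<lambda>q u.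
     case label \<Phi> u of
       Var v \<Rightarrow> y v
     | Const c \<Rightarrow> c
     | Product_Node \<Rightarrow> (\<Prod>v\<in>children \<Phi> u. q v)
     | Sum_Node \<Rightarrow> (\<Sum>v\<in>children \<Phi> u. weight \<Phi> (v, u) * q v))"

definition circuit_value :: "('a, 'v) circuit \<Rightarrow> ('v \<Rightarrow> real) \<Rightarrow> real" where
  "circuit_value \<Phi> y = node_value \<Phi> y (root \<Phi>)"

lemma node_value_eq:
  assumes "arithmetic_circuit V \<Phi>"
  shows "node_value \<Phi> y u =
    (case label \<Phi> u of
       Var v \<Rightarrow> y v
     | Const c \<Rightarrow> c
     | Product_Node \<Rightarrow> (\<Prod>v\<in>children \<Phi> u. node_value \<Phi> y v)
     | Sum_Node \<Rightarrow> (\<Sum>v\<in>children \<Phi> u. weight \<Phi> (v, u) * node_value \<Phi> y v))"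
proof -
  have "wf (parcs (dag \<Phi>))"
    using assms by (auto simp: arithmetic_circuit_def pair_fin_digraph_def
      pair_fin_digraph_axioms_def intro: finite_acyclic_wf)
  from wfrec[OF this] show ?thesis
    unfolding node_value_def
    by (subst wfrec[OF \<open>wf (parcs (dag \<Phi>))\<close>])
       (auto simp: cut_apply children_def split: node_label.split intro!: prod.cong sum.cong)
qed


section \<open>Sum product networks\<close>

text \<open>The input variables are \<open>x\<^sub>1, \<dots>, x\<^sub>n\<close>, where \<open>x\<^sub>i\<close> ranges over the space of the
  measure \<open>M i\<close>. The univariate functions of \<open>x\<^sub>i\<close> are \<open>f i 1, \<dots>, f i (k i)\<close>, and the
  circuit variable \<open>(i, j)\<close> stands for \<open>f i j\<close>.\<close>

definition spn ::
    "nat \<Rightarrow> (nat \<Rightarrow> real measure) \<Rightarrow> (nat \<Rightarrow> nat) \<Rightarrow> (nat \<Rightarrow> nat \<Rightarrow> real \<Rightarrow> real) \<Rightarrow>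
     ('a, nat \<times> nat) circuit \<Rightarrow> bool" where
  "spn n M k f \<Phi> \<longleftrightarrow>
     (\<forall>i\<in>{1..n}. \<forall>j\<in>{1..k i}. integrable (M i) (f i j) \<and> (\<forall>t\<in>space (M i). 0 \<le> f i j t)) \<and>
     arithmetic_circuit (SIGMA i:{1..n}. {1..k i}) \<Phi> \<and> monotone_circuit \<Phi>"

definition spn_output ::
    "(nat \<Rightarrow> nat \<Rightarrow> real \<Rightarrow> real) \<Rightarrow> ('a, nat \<times> nat) circuit \<Rightarrow> (nat \<Rightarrow> real) \<Rightarrow> real" where
  "spn_output f \<Phi> x = circuit_value \<Phi> (\<lambda>(i, j). f i j (x i))"

definition dependency_scope :: "('a, nat \<times> nat) circuit \<Rightarrow> 'a \<Rightarrow> nat set" where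
  "dependency_scope \<Phi> u =
     {i. \<exists>w j. w \<rightarrow>\<^sup>*\<^bsub>with_proj (dag \<Phi>)\<^esub> u \<and> label \<Phi> w = Var (i, j)}"

definition decomposable :: "('a, nat \<times> nat) circuit \<Rightarrow> bool" where
  "decomposable \<Phi> \<longleftrightarrow>
     (\<forall>u\<in>nodes \<Phi>. label \<Phi> u = Product_Node \<longrightarrow>
        (\<forall>v\<in>children \<Phi> u. \<forall>w\<in>children \<Phi> u.
           v \<noteq> w \<longrightarrow> dependency_scope \<Phi> v \<inter> dependency_scope \<Phi> w = {}))"

definition complete_spn :: "('a, nat \<times> nat) circuit \<Rightarrow> bool" where
  "complete_spn \<Phi> \<longleftrightarrow>
     (\<forall>u\<in>nodes \<Phi>. label \<Phi> u = Sum_Node \<longrightarrow>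
        (\<forall>v\<in>children \<Phi> u. \<forall>w\<in>children \<Phi> u.
           dependency_scope \<Phi> v = dependency_scope \<Phi> w))"

definition dc_spn ::
    "nat \<Rightarrow> (nat \<Rightarrow> real measure) \<Rightarrow> (nat \<Rightarrow> nat) \<Rightarrow> (nat \<Rightarrow> nat \<Rightarrow> real \<Rightarrow> real) \<Rightarrow>
     ('a, nat \<times> nat) circuit \<Rightarrow> bool" where
  "dc_spn n M k f \<Phi> \<longleftrightarrow> spn n M k f \<Phi> \<and> decomposable \<Phi> \<and> complete_spn \<Phi>"


section \<open>Spanning trees of the complete graph\<close>

text \<open>An undirected graph is a symmetric loop-free digraph without parallel arcs. The
  library's \<open>forest\<close> forbids directed cycles, so it would also forbid the cycle \<open>u, v, u\<close>
  that every edge of a symmetric digraph gives rise to. The cycles of the undirected graph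
  are those of length at least 3.\<close>

definition undirected_tree :: "('a, 'b) pre_digraph \<Rightarrow> bool" where
  "undirected_tree G \<longleftrightarrow>
     Digraph_Component.connected G \<and> \<not> (\<exists>p. pre_digraph.cycle G p \<and> 3 \<le> length p)"

definition undirected_spanning_tree ::
    "('a, 'b) pre_digraph \<Rightarrow> ('a, 'b) pre_digraph \<Rightarrow> bool" where
  "undirected_spanning_tree H G \<longleftrightarrow> undirected_tree H \<and> spanning H G"

definition complete_pair_graph :: "nat \<Rightarrow> nat pair_pre_digraph" where
  "complete_pair_graph m =
     \<lparr>pverts = {1..m}, parcs = {(u, v). u \<in> {1..m} \<and> v \<in> {1..m} \<and> u \<noteq> v}\<rparr>"

lemma complete_digraph_complete_pair_graph: "complete_digraph m (with_proj (complete_pair_graph m))"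
  by (simp add: complete_digraph_pair_def complete_pair_graph_def)

definition undirected_edges :: "'a pair_pre_digraph \<Rightarrow> 'a set set" where
  "undirected_edges G = {{u, v} |u v. (u, v) \<in> parcs G}"

text \<open>\<open>e\<close> is the labelling of the edges of the complete graph by \<open>1, \<dots>, n\<close>, and
  \<open>x\<close> is a 0/1 vector indexed by \<open>1, \<dots>, n\<close>.\<close>

definition graph_of ::
    "nat \<Rightarrow> nat \<Rightarrow> (nat \<Rightarrow> nat set) \<Rightarrow> (nat \<Rightarrow> real) \<Rightarrow> nat pair_pre_digraph" where
  "graph_of m n e x =
     \<lparr>pverts = {1..m}, parcs = {(u, v). \<exists>i\<in>{1..n}. x i = 1 \<and> e i = {u, v}}\<rparr>"

definition spanning_tree_vectors ::
    "nat \<Rightarrow> nat \<Rightarrow> (nat \<Rightarrow> nat set) \<Rightarrow> (nat \<Rightarrow> real) set" where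
  "spanning_tree_vectors m n e =
     {x \<in> {1..n} \<rightarrow>\<^sub>E {0, 1}.
        undirected_spanning_tree (with_proj (graph_of m n e x)) (with_proj (complete_pair_graph m))}"

text \<open>The density, with respect to counting measure, of the uniform distribution. The
  common value \<open>1 / m ^ (m - 2)\<close> on the spanning trees is Cayley's formula.\<close>

definition spanning_tree_density ::
    "nat \<Rightarrow> nat \<Rightarrow> (nat \<Rightarrow> nat set) \<Rightarrow> (nat \<Rightarrow> real) \<Rightarrow> real" where
  "spanning_tree_density m n e x = pmf (pmf_of_set (spanning_tree_vectors m n e)) x"

end

theory Submission
  imports Defs
begin

text \<open>Expanding a circuit at nodes of balanced scope bounds its output from above by a sum of
  at most \<open>s\<close> products \<open>g\<^sub>u h\<^sub>u\<close>, each of them pointwise below the output, where \<open>g\<^sub>u\<close> and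
  \<open>h\<^sub>u\<close> depend on complementary sets of variables, each with at least a third of the edges.
  If the output is close to the density, then the points where one of the products is large
  form a set of spanning trees that is closed under exchanging the parts on the two sides,
  and these sets cover all spanning trees.

  Consider a triangle with edges on both sides. Some two edges lie on the same side and the third
  on the other, so no such set can contain both a tree with the first two edges and a tree with
  the third. Hence of the three patterns in which a spanning tree may contain two edges
  of the triangle, at least one is excluded. Since a positive fraction of all triangles is of
  this kind for each set, one can pick linearly many disjoint triangles such that, among the trees
  that contain two edges of each of them, every set covers only an exponentially small
  fraction on average.\<close>

section \<open>Balanced expansions of circuits\<close>

definition depends_on :: "((nat \<Rightarrow> real) \<Rightarrow> real) \<Rightarrow> nat set \<Rightarrow> bool" where
  "depends_on g A \<longleftrightarrow> (\<forall>x y. (\<forall>i\<in>A. x i = y i) \<longrightarrow> g x = g y)"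

lemma depends_on_mono: "depends_on g A \<Longrightarrow> A \<subseteq> B \<Longrightarrow> depends_on g B"
  by (auto simp: depends_on_def subset_iff)

lemma depends_on_const [simp]: "depends_on (\<lambda>_. c) A"
  by (simp add: depends_on_def)

lemma depends_on_mult:
  "depends_on g A \<Longrightarrow> depends_on h A \<Longrightarrow> depends_on (\<lambda>x. g x * h x) A"
  unfolding depends_on_def by metis

lemma depends_on_sum:
  "(\<And>v. v \<in> I \<Longrightarrow> depends_on (g v) A) \<Longrightarrow> depends_on (\<lambda>x. \<Sum>v\<in>I. g v x) A"
  unfolding depends_on_def by (auto intro!: sum.cong)

lemma depends_on_prod:
  "(\<And>v. v \<in> I \<Longrightarrow> depends_on (g v) A) \<Longrightarrow> depends_on (\<lambda>x. \<Prod>v\<in>I. g v x) A"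
  unfolding depends_on_def by (auto intro!: prod.cong)

text \<open>Add the sets one at a time: when the union first reaches a third of \<open>n\<close>,
  the last set has contributed less than another third, so two thirds are not exceeded.\<close>

lemma balanced_subunion:
  fixes A :: "'b \<Rightarrow> 'c set"
  assumes "finite I" and "\<And>v. v \<in> I \<Longrightarrow> finite (A v) \<and> 3 * card (A v) < n"
    and "n \<le> 3 * card (\<Union>v\<in>I. A v)"
  shows "\<exists>C\<subseteq>I. n \<le> 3 * card (\<Union>v\<in>C. A v) \<and> 3 * card (\<Union>v\<in>C. A v) \<le> 2 * n"
  using assms
proof (induction I rule: finite_induct)
  case empty
  then show ?case by auto
next
  case (insert a I)
  show ?case
  proof (cases "n \<le> 3 * card (\<Union>v\<in>I. A v)")
    case True
    with insert.IH insert.prems show ?thesis by blast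
  next
    case False
    have "card (\<Union>v\<in>insert a I. A v) \<le> card (A a) + card (\<Union>v\<in>I. A v)"
      by (simp add: card_Un_le)
    then have "3 * card (\<Union>v\<in>insert a I. A v) \<le> 2 * n"
      using insert.prems(1)[of a] False by auto
    with insert.prems(2) show ?thesis by blast
  qed
qed

section \<open>Scopes and values of the nodes of a Boolean D&C SPN\<close>

locale boolean_dc_spn =
  fixes n :: nat and k :: "nat \<Rightarrow> nat" and f :: "nat \<Rightarrow> nat \<Rightarrow> real \<Rightarrow> real"
    and \<Phi> :: "('a, nat \<times> nat) circuit"
  assumes dc: "dc_spn n (\<lambda>_. count_space {0, 1}) k f \<Phi>"
begin

abbreviation "scope \<equiv> dependency_scope \<Phi>"

definition val :: "'a \<Rightarrow> (nat \<Rightarrow> real) \<Rightarrow> real" where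
  "val u x = node_value \<Phi> (\<lambda>(i, j). f i j (x i)) u"

definition cube :: "(nat \<Rightarrow> real) set" where
  "cube = {x. \<forall>i\<in>{1..n}. x i \<in> {0, 1}}"

lemma circuit: "arithmetic_circuit (SIGMA i:{1..n}. {1..k i}) \<Phi>"
  and mono: "monotone_circuit \<Phi>"
  and decomp: "decomposable \<Phi>"
  and compl: "complete_spn \<Phi>"
  and f_nonneg: "i \<in> {1..n} \<Longrightarrow> j \<in> {1..k i} \<Longrightarrow> t \<in> {0, 1} \<Longrightarrow> 0 \<le> f i j t"
  using dc by (auto simp: dc_spn_def spn_def)

lemma fin_digraph: "pair_fin_digraph (dag \<Phi>)"
  and acyc: "acyclic (parcs (dag \<Phi>))"
  using circuit by (auto simp: arithmetic_circuit_def)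

lemma finite_parcs: "finite (parcs (dag \<Phi>))" and finite_nodes: "finite (nodes \<Phi>)"
  using fin_digraph by (auto simp: nodes_def pair_fin_digraph_def pair_fin_digraph_axioms_def)

lemma wf_parcs: "wf (parcs (dag \<Phi>))"
  using finite_acyclic_wf[OF finite_parcs acyc] .

lemma parcs_nodes: "(v, u) \<in> parcs (dag \<Phi>) \<Longrightarrow> v \<in> nodes \<Phi> \<and> u \<in> nodes \<Phi>"
  using fin_digraph unfolding nodes_def pair_fin_digraph_def pair_wf_digraph_def by force

lemma children_nodes: "v \<in> children \<Phi> u \<Longrightarrow> v \<in> nodes \<Phi>"
  using parcs_nodes by (auto simp: children_def)

lemma finite_children: "finite (children \<Phi> u)"
  using finite_subset[OF _ finite_nodes] children_nodes by blast

lemma in_degree_0_iff: "in_degree (with_proj (dag \<Phi>)) u = 0 \<longleftrightarrow> children \<Phi> u = {}"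
proof -
  have "finite (in_arcs (with_proj (dag \<Phi>)) u)"
    using finite_parcs by (auto simp: in_arcs_def intro: finite_subset)
  then show ?thesis by (auto simp: in_degree_def in_arcs_def children_def)
qed

lemma root_in_nodes: "root \<Phi> \<in> nodes \<Phi>"
proof -
  have "\<exists>!r. is_root \<Phi> r" using circuit by (simp add: arithmetic_circuit_def)
  then have "is_root \<Phi> (root \<Phi>)" unfolding root_def by (rule theI')
  then show ?thesis by (simp add: is_root_def)
qed

lemma label_cases:
  assumes "u \<in> nodes \<Phi>"
  obtains (Var) i j where "label \<Phi> u = Var (i, j)" "i \<in> {1..n}" "j \<in> {1..k i}" "children \<Phi> u = {}"
  | (Const) c where "label \<Phi> u = Const c" "0 \<le> c" "children \<Phi> u = {}"
  | (Product) "label \<Phi> u = Product_Node"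
  | (Sum) "label \<Phi> u = Sum_Node" "\<forall>v\<in>children \<Phi> u. 0 \<le> weight \<Phi> (v, u)" "children \<Phi> u \<noteq> {}"
  using circuit mono assms that
  unfolding arithmetic_circuit_def monotone_circuit_def in_degree_0_iff
  by (smt (verit) SigmaE insertE singletonD)

lemma scope_unfold:
  assumes "u \<in> nodes \<Phi>"
  shows "scope u = {i. \<exists>j. label \<Phi> u = Var (i, j)} \<union> (\<Union>v\<in>children \<Phi> u. scope v)"
proof -
  have "w \<rightarrow>\<^sup>*\<^bsub>with_proj (dag \<Phi>)\<^esub> u \<longleftrightarrow> w = u \<or> (\<exists>v\<in>children \<Phi> u. w \<rightarrow>\<^sup>*\<^bsub>with_proj (dag \<Phi>)\<^esub> v)" for w
    using assms unfolding reachable_def children_def nodes_def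
    by (auto elim: rtrancl_on.cases intro: rtrancl_on_into_rtrancl_on)
  then show ?thesis by (auto simp: dependency_scope_def)
qed

lemma node_induct [consumes 1, case_names node]:
  assumes "u \<in> nodes \<Phi>"
    and "\<And>u. u \<in> nodes \<Phi> \<Longrightarrow> (\<And>v. v \<in> children \<Phi> u \<Longrightarrow> P v) \<Longrightarrow> P u"
  shows "P u"
  using assms(1)
proof (induction u rule: wf_induct_rule[OF wf_parcs])
  case (1 u)
  then show ?case using assms(2) children_nodes by (auto simp: children_def)
qed

lemma val_eq:
  "val u x = (case label \<Phi> u of
       Var (i, j) \<Rightarrow> f i j (x i)
     | Const c \<Rightarrow> c
     | Product_Node \<Rightarrow> (\<Prod>v\<in>children \<Phi> u. val v x)
     | Sum_Node \<Rightarrow> (\<Sum>v\<in>children \<Phi> u. weight \<Phi> (v, u) * val v x))"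
  unfolding val_def by (subst node_value_eq[OF circuit]) (auto split: node_label.split)

lemma spn_output_eq_val: "spn_output f \<Phi> x = val (root \<Phi>) x"
  by (simp add: spn_output_def circuit_value_def val_def)

lemma scope_subset: "u \<in> nodes \<Phi> \<Longrightarrow> scope u \<subseteq> {1..n}"
proof (induction u rule: node_induct)
  case (node u)
  from node(1) show ?case
    by (cases rule: label_cases) (use node scope_unfold[OF node(1)] in auto)
qed

lemma finite_scope: "u \<in> nodes \<Phi> \<Longrightarrow> finite (scope u)"
  using scope_subset finite_subset by blast

lemma scope_child: "u \<in> nodes \<Phi> \<Longrightarrow> v \<in> children \<Phi> u \<Longrightarrow> scope v \<subseteq> scope u"
  using scope_unfold by blast

lemma depends_on_val: "u \<in> nodes \<Phi> \<Longrightarrow> depends_on (val u) (scope u)"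
proof (induction u rule: node_induct)
  case (node u)
  have *: "depends_on (val v) (scope u)" if "v \<in> children \<Phi> u" for v
    using node(2)[OF that] scope_child[OF node(1) that] depends_on_mono by blast
  from node(1) show ?case
  proof (cases rule: label_cases)
    case (Var i j)
    then have "i \<in> scope u" using scope_unfold[OF node(1)] by auto
    then show ?thesis using Var by (auto simp: depends_on_def val_eq[of u])
  next
    case (Const c)
    then show ?thesis by (auto simp: depends_on_def val_eq[of u])
  next
    case Product
    then have "val u = (\<lambda>x. \<Prod>v\<in>children \<Phi> u. val v x)" by (auto simp: val_eq[of u])
    then show ?thesis using * by (simp add: depends_on_prod)
  next
    case Sum
    then have "val u = (\<lambda>x. \<Sum>v\<in>children \<Phi> u. weight \<Phi> (v, u) * val v x)"
      by (auto simp: val_eq[of u])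
    then show ?thesis using * by (simp add: depends_on_sum depends_on_mult)
  qed
qed

lemma val_nonneg: "u \<in> nodes \<Phi> \<Longrightarrow> x \<in> cube \<Longrightarrow> 0 \<le> val u x"
proof (induction u rule: node_induct)
  case (node u)
  from node(1) show ?case
  proof (cases rule: label_cases)
    case (Var i j)
    then show ?thesis using f_nonneg[of i j "x i"] node(3) by (auto simp: cube_def val_eq[of u])
  qed (use node in \<open>auto simp: val_eq[of u] intro!: prod_nonneg sum_nonneg mult_nonneg_nonneg\<close>)
qed

text \<open>A product node of large scope whose children all have small scopes is a cut node as well,
  because its children can be split into two groups of comparable scope.\<close>

definition cut_nodes :: "'a set" where
  "cut_nodes = {u \<in> nodes \<Phi>. n \<le> 3 * card (scope u) \<and> (3 * card (scope u) \<le> 2 * n \<or>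
     label \<Phi> u = Product_Node \<and> (\<forall>v\<in>children \<Phi> u. 3 * card (scope v) < n))}"

lemma finite_cut_nodes: "finite cut_nodes"
  using finite_nodes by (auto simp: cut_nodes_def)

text \<open>The function \<open>h u\<close> plays the role of the partial derivative of \<open>val w\<close> with respect to
  the value of \<open>u\<close>. Every parse tree below a node \<open>w\<close> of large scope meets a cut node, as
  one sees by descending from \<open>w\<close> to children of large scope.\<close>

definition cut_expansion :: "'a \<Rightarrow> ('a \<Rightarrow> (nat \<Rightarrow> real) \<Rightarrow> real) \<Rightarrow> bool" where
  "cut_expansion w h \<longleftrightarrow>
     (\<forall>u\<in>cut_nodes. depends_on (h u) (scope w - scope u) \<and>
                ((\<forall>x. h u x = 0) \<or> scope u \<subseteq> scope w)) \<and>
     (\<forall>x\<in>cube. (\<forall>u\<in>cut_nodes. 0 \<le> h u x \<and> h u x * val u x \<le> val w x) \<and>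
                val w x \<le> (\<Sum>u\<in>cut_nodes. h u x * val u x))"

lemma cut_expansionD:
  assumes "cut_expansion w h"
  shows "u \<in> cut_nodes \<Longrightarrow> depends_on (h u) (scope w - scope u)"
    and "u \<in> cut_nodes \<Longrightarrow> (\<forall>x. h u x = 0) \<or> scope u \<subseteq> scope w"
    and "x \<in> cube \<Longrightarrow> u \<in> cut_nodes \<Longrightarrow> 0 \<le> h u x"
    and "x \<in> cube \<Longrightarrow> u \<in> cut_nodes \<Longrightarrow> h u x * val u x \<le> val w x"
    and "x \<in> cube \<Longrightarrow> val w x \<le> (\<Sum>u\<in>cut_nodes. h u x * val u x)"
  using assms by (auto simp: cut_expansion_def)

text \<open>Induction on \<open>w\<close>. A cut node is its own expansion. Otherwise, at a product
  node, some child still has a large scope, and its expansion is multiplied by the remaining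
  factors; at a sum node, completeness makes every child as large as \<open>w\<close>, and the
  expansions are added with the weights.\<close>

lemma cut_expansion_exists:
  assumes "3 < n" "w \<in> nodes \<Phi>" "n \<le> 3 * card (scope w)"
  shows "\<exists>h. cut_expansion w h"
  using assms(2,3)
proof (induction w rule: node_induct)
  case (node w)
  show ?case
  proof (cases "w \<in> cut_nodes")
    case True
    define h :: "'a \<Rightarrow> (nat \<Rightarrow> real) \<Rightarrow> real" where "h = (\<lambda>u x. if u = w then 1 else 0)"
    have "depends_on (h u) (scope w - scope u)" for u
      by (auto simp: h_def depends_on_def)
    moreover have "(\<Sum>u\<in>cut_nodes. h u x * val u x) = val w x" for x
      using True finite_cut_nodes by (simp add: h_def if_distrib[of "\<lambda>a. a * _"] cong: if_cong)
    moreover have "h u x * val u x \<le> val w x" if "x \<in> cube" for u x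
      using that node(1) val_nonneg by (auto simp: h_def)
    moreover have "0 \<le> h u x" "(\<forall>x. h u x = 0) \<or> scope u \<subseteq> scope w" for u x
      by (auto simp: h_def)
    ultimately show ?thesis unfolding cut_expansion_def by (intro exI[of _ h]) simp
  next
    case False
    \<comment> \<open>A large node that is no cut node has more than two thirds of the variables in
      its scope, which rules out both kinds of leaves.\<close>
    with node have big: "2 * n < 3 * card (scope w)" by (auto simp: cut_nodes_def)
    from node(1) show ?thesis
    proof (cases rule: label_cases)
      case (Var i j)
      then have "scope w = {i}" using scope_unfold[OF node(1)] by auto
      with big assms(1) show ?thesis by simp
    next
      case (Const c)
      then have "scope w = {}" using scope_unfold[OF node(1)] by auto
      with big show ?thesis by simp
    next
      case Product
      with False node obtain v where v: "v \<in> children \<Phi> w" "n \<le> 3 * card (scope v)"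
        by (auto simp: cut_nodes_def not_less)
      from node(2)[OF this] obtain h where "cut_expansion v h" by blast
      note h = cut_expansionD[OF this]
      define r where "r = (\<lambda>x. \<Prod>v'\<in>children \<Phi> w - {v}. val v' x)"
      have val_w: "val w x = val v x * r x" for x
        using Product v(1) by (simp add: val_eq[of w] r_def prod.remove[OF finite_children])
      have r_nonneg: "0 \<le> r x" if "x \<in> cube" for x
        unfolding r_def using that children_nodes val_nonneg by (auto intro!: prod_nonneg)
      have dep: "depends_on r (scope w - scope v)"
        unfolding r_def
      proof (rule depends_on_prod)
        fix v' assume v': "v' \<in> children \<Phi> w - {v}"
        then have "scope v' \<inter> scope v = {}"
          using decomp node(1) Product v(1) by (auto simp: decomposable_def)
        then show "depends_on (val v') (scope w - scope v)"
          using v' scope_child[OF node(1), of v'] children_nodes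
          by (intro depends_on_mono[OF depends_on_val]) auto
      qed
      define h2 where "h2 = (\<lambda>u x. h u x * r x)"
      \<comment> \<open>By decomposability \<open>r\<close> avoids \<open>scope v\<close>. It avoids
        \<open>scope u\<close> because \<open>scope u \<subseteq> scope v\<close>, unless
        \<open>h u\<close> vanishes; the second clause of \<open>cut_expansion\<close> carries this
        alternative.\<close>
      have "depends_on (h2 u) (scope w - scope u)" if u: "u \<in> cut_nodes" for u
        using h(2)[OF u]
      proof
        assume "scope u \<subseteq> scope v"
        then show ?thesis
          unfolding h2_def using scope_child[OF node(1) v(1)]
          by (intro depends_on_mult depends_on_mono[OF h(1)[OF u]] depends_on_mono[OF dep]) auto
      qed (simp add: h2_def)
      moreover have "(\<forall>x. h2 u x = 0) \<or> scope u \<subseteq> scope w" if "u \<in> cut_nodes" for u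
        using h(2)[OF that] scope_child[OF node(1) v(1)] by (auto simp: h2_def)
      moreover have "0 \<le> h2 u x" "h2 u x * val u x \<le> val w x" if "x \<in> cube" "u \<in> cut_nodes" for u x
        using h(3,4)[OF that] r_nonneg[OF that(1)] mult_right_mono[of "h u x * val u x" "val v x" "r x"]
        by (auto simp: h2_def val_w mult_ac)
      moreover have "val w x \<le> (\<Sum>u\<in>cut_nodes. h2 u x * val u x)" if "x \<in> cube" for x
      proof -
        have "(\<Sum>u\<in>cut_nodes. h2 u x * val u x) = (\<Sum>u\<in>cut_nodes. h u x * val u x) * r x"
          unfolding h2_def sum_distrib_right by (simp add: mult_ac)
        then show ?thesis
          using mult_right_mono[OF h(5)[OF that] r_nonneg[OF that]] val_w by simp
      qed
      ultimately show ?thesis unfolding cut_expansion_def by (intro exI[of _ h2]) simp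
    next
      case Sum
      have sc: "scope v = scope w" if "v \<in> children \<Phi> w" for v
      proof -
        have "scope v' = scope v" if "v' \<in> children \<Phi> w" for v'
          by (rule compl[unfolded complete_spn_def, rule_format, OF node(1) Sum(1) that])
             (rule \<open>v \<in> children \<Phi> w\<close>)
        then have "(\<Union>v'\<in>children \<Phi> w. scope v') = scope v"
          using that by blast
        then show ?thesis using Sum(1) by (simp add: scope_unfold[OF node(1)])
      qed
      have "\<forall>v\<in>children \<Phi> w. \<exists>h. cut_expansion v h"
        using node(2,3) sc by simp
      then obtain h where "\<And>v. v \<in> children \<Phi> w \<Longrightarrow> cut_expansion v (h v)" by metis
      note h = cut_expansionD[OF this]
      define h2 where "h2 = (\<lambda>u x. \<Sum>v\<in>children \<Phi> w. weight \<Phi> (v, w) * h v u x)"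
      have val_w: "val w x = (\<Sum>v\<in>children \<Phi> w. weight \<Phi> (v, w) * val v x)" for x
        using Sum by (simp add: val_eq[of w])
      have "depends_on (h2 u) (scope w - scope u)" if "u \<in> cut_nodes" for u
        unfolding h2_def using h(1) that sc by (simp add: depends_on_sum depends_on_mult)
      moreover have "(\<forall>x. h2 u x = 0) \<or> scope u \<subseteq> scope w" if "u \<in> cut_nodes" for u
      proof (cases "scope u \<subseteq> scope w")
        case False
        have "h v u x = 0" if "v \<in> children \<Phi> w" for v x
          using h(2)[OF that \<open>u \<in> cut_nodes\<close>] sc[OF that] False by simp
        then show ?thesis by (simp add: h2_def)
      qed simp
      moreover have "0 \<le> h2 u x" if "x \<in> cube" "u \<in> cut_nodes" for u x
        unfolding h2_def using Sum h(3) that by (auto intro!: sum_nonneg mult_nonneg_nonneg)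
      moreover have "h2 u x * val u x \<le> val w x" if "x \<in> cube" "u \<in> cut_nodes" for u x
        unfolding h2_def val_w sum_distrib_right mult.assoc
        using Sum h(4) that by (auto intro!: sum_mono mult_left_mono)
      moreover have "val w x \<le> (\<Sum>u\<in>cut_nodes. h2 u x * val u x)" if "x \<in> cube" for x
      proof -
        have "val w x \<le> (\<Sum>v\<in>children \<Phi> w. weight \<Phi> (v, w) * (\<Sum>u\<in>cut_nodes. h v u x * val u x))"
          unfolding val_w using Sum h(5) that by (auto intro!: sum_mono mult_left_mono)
        also have "\<dots> = (\<Sum>u\<in>cut_nodes. h2 u x * val u x)"
          unfolding h2_def sum_distrib_right sum_distrib_left
          by (subst sum.swap) (simp add: mult.assoc)
        finally show ?thesis .
      qed
      ultimately show ?thesis unfolding cut_expansion_def by (intro exI[of _ h2]) simp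
    qed
  qed
qed

text \<open>The expansion at the root yields terms \<open>h u * val u\<close>. If
  \<open>scope u\<close> exceeds two thirds, \<open>val u\<close> is a product of children of small
  scope and is split further. A root of small scope needs no expansion: the output itself serves as
  the only product.\<close>

lemma balanced_product_cover:
  assumes "3 < n"
  shows "\<exists>(B :: 'a set) Y g h. finite B \<and> card B \<le> circuit_size \<Phi> \<and>
    (\<forall>u\<in>B. Y u \<subseteq> {1..n} \<and> n \<le> 3 * card (Y u) \<and> 3 * card (Y u) \<le> 2 * n \<and>
       depends_on (g u) (Y u) \<and> depends_on (h u) ({1..n} - Y u)) \<and>
    (\<forall>x\<in>cube. (\<forall>u\<in>B. 0 \<le> g u x \<and> 0 \<le> h u x \<and> g u x * h u x \<le> spn_output f \<Phi> x) \<and>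
       spn_output f \<Phi> x \<le> (\<Sum>u\<in>B. g u x * h u x))"
proof (cases "n \<le> 3 * card (scope (root \<Phi>))")
  case True
  obtain h where "cut_expansion (root \<Phi>) h"
    using cut_expansion_exists[OF assms root_in_nodes True] by blast
  note h = cut_expansionD[OF this]
  have "\<exists>Y g r. Y \<subseteq> scope u \<and> n \<le> 3 * card Y \<and> 3 * card Y \<le> 2 * n \<and>
      depends_on g Y \<and> depends_on r (scope u - Y) \<and>
      (\<forall>x\<in>cube. 0 \<le> g x \<and> 0 \<le> r x \<and> val u x = g x * r x)" if u: "u \<in> cut_nodes" for u
  proof (cases "3 * card (scope u) \<le> 2 * n")
    case True
    then show ?thesis
      using u depends_on_val val_nonneg
      by (intro exI[of _ "scope u"] exI[of _ "val u"] exI[of _ "\<lambda>_. 1"]) (auto simp: cut_nodes_def)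
  next
    case False
    with u have u': "u \<in> nodes \<Phi>" "label \<Phi> u = Product_Node" "n \<le> 3 * card (scope u)"
      "\<forall>v\<in>children \<Phi> u. 3 * card (scope v) < n" by (auto simp: cut_nodes_def)
    have sc: "scope u = (\<Union>v\<in>children \<Phi> u. scope v)"
      using scope_unfold[OF u'(1)] u'(2) by auto
    obtain C where C: "C \<subseteq> children \<Phi> u" "n \<le> 3 * card (\<Union>v\<in>C. scope v)"
      "3 * card (\<Union>v\<in>C. scope v) \<le> 2 * n"
      using balanced_subunion[OF finite_children[of u], of scope n] u' sc finite_scope
        children_nodes by metis
    define D where "D = children \<Phi> u - C"
    define g where "g = (\<lambda>x. \<Prod>v\<in>C. val v x)"
    define r where "r = (\<lambda>x. \<Prod>v\<in>D. val v x)"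
    have "val u x = g x * r x" for x
      unfolding g_def r_def D_def using u'(2) prod.subset_diff[OF C(1) finite_children]
      by (simp add: val_eq[of u] mult.commute)
    moreover have "depends_on g (\<Union>v\<in>C. scope v)"
      unfolding g_def using C(1) children_nodes
      by (intro depends_on_prod depends_on_mono[OF depends_on_val]) auto
    moreover have "depends_on r (scope u - (\<Union>v\<in>C. scope v))"
      unfolding r_def
    proof (intro depends_on_prod depends_on_mono[OF depends_on_val])
      fix v assume v: "v \<in> D"
      then show "v \<in> nodes \<Phi>" using children_nodes by (auto simp: D_def)
      have "scope v \<inter> scope v' = {}" if "v' \<in> C" for v'
        using that v C(1) decomp[unfolded decomposable_def, rule_format, OF u'(1,2), of v v']
        by (auto simp: D_def)
      then show "scope v \<subseteq> scope u - (\<Union>v\<in>C. scope v)"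
        using scope_child[OF u'(1), of v] v by (auto simp: D_def)
    qed
    moreover have "0 \<le> g x" "0 \<le> r x" if "x \<in> cube" for x
      unfolding g_def r_def D_def using that C(1) children_nodes val_nonneg
      by (auto intro!: prod_nonneg)
    moreover have "(\<Union>v\<in>C. scope v) \<subseteq> scope u" using C(1) sc by auto
    ultimately show ?thesis using C by blast
  qed
  then obtain Y g r where
    Y: "\<And>u. u \<in> cut_nodes \<Longrightarrow> Y u \<subseteq> scope u \<and> n \<le> 3 * card (Y u) \<and> 3 * card (Y u) \<le> 2 * n \<and>
      depends_on (g u) (Y u) \<and> depends_on (r u) (scope u - Y u)" and
    Y': "\<And>u x. u \<in> cut_nodes \<Longrightarrow> x \<in> cube \<Longrightarrow> 0 \<le> g u x \<and> 0 \<le> r u x \<and> val u x = g u x * r u x"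
    by metis
  \<comment> \<open>The leftover factor \<open>r u\<close> joins the other side: it depends on
    \<open>scope u - Y u\<close> and \<open>h u\<close> on variables outside \<open>scope u\<close>,
    so neither touches \<open>Y u\<close>.\<close>
  define h2 where "h2 = (\<lambda>u x. r u x * h u x)"
  have eq: "g u x * h2 u x = h u x * val u x" if "x \<in> cube" "u \<in> cut_nodes" for u x
    using Y'[OF that(2,1)] by (simp add: h2_def)
  have "card cut_nodes \<le> circuit_size \<Phi>"
    unfolding circuit_size_def by (rule card_mono[OF finite_nodes]) (auto simp: cut_nodes_def)
  moreover have "\<forall>u\<in>cut_nodes. Y u \<subseteq> {1..n} \<and> n \<le> 3 * card (Y u) \<and> 3 * card (Y u) \<le> 2 * n \<and>
      depends_on (g u) (Y u) \<and> depends_on (h2 u) ({1..n} - Y u)"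
  proof
    fix u assume u: "u \<in> cut_nodes"
    then have sub: "scope u \<subseteq> {1..n}" "scope (root \<Phi>) \<subseteq> {1..n}"
      using scope_subset root_in_nodes by (auto simp: cut_nodes_def)
    have "depends_on (h2 u) ({1..n} - Y u)"
      unfolding h2_def using Y[OF u] h(1)[OF u] sub
      by (intro depends_on_mult) (auto elim!: depends_on_mono)
    then show "Y u \<subseteq> {1..n} \<and> n \<le> 3 * card (Y u) \<and> 3 * card (Y u) \<le> 2 * n \<and>
      depends_on (g u) (Y u) \<and> depends_on (h2 u) ({1..n} - Y u)" using Y[OF u] sub by auto
  qed
  moreover have "\<forall>x\<in>cube. (\<forall>u\<in>cut_nodes. 0 \<le> g u x \<and> 0 \<le> h2 u x \<and> g u x * h2 u x \<le> spn_output f \<Phi> x) \<and>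
       spn_output f \<Phi> x \<le> (\<Sum>u\<in>cut_nodes. g u x * h2 u x)"
    using h(3-5) Y' eq by (simp add: spn_output_eq_val h2_def mult_ac)
  ultimately show ?thesis using finite_cut_nodes
    by (intro exI[of _ cut_nodes] exI[of _ Y] exI[of _ g] exI[of _ h2] conjI)
next
  case False
  \<comment> \<open>The small scope is padded to half of the variables, which is balanced; the
    cofactor is the constant 1.\<close>
  have "\<exists>Y. scope (root \<Phi>) \<subseteq> Y \<and> Y \<subseteq> {1..n} \<and> card Y = n div 2"
    using False scope_subset[OF root_in_nodes] by (intro exists_subset_between) auto
  then obtain Y where Y: "scope (root \<Phi>) \<subseteq> Y" "Y \<subseteq> {1..n}" "card Y = n div 2" by blast
  have "card {root \<Phi>} \<le> circuit_size \<Phi>"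
    unfolding circuit_size_def using root_in_nodes by (intro card_mono finite_nodes) auto
  moreover have "depends_on (val (root \<Phi>)) Y"
    using depends_on_mono[OF depends_on_val[OF root_in_nodes] Y(1)] .
  moreover have "n \<le> 3 * card Y" "3 * card Y \<le> 2 * n" using Y(3) assms by linarith+
  ultimately show ?thesis using Y(2) val_nonneg[OF root_in_nodes]
    by (intro exI[of _ "{root \<Phi>}"] exI[of _ "\<lambda>_. Y"] exI[of _ "\<lambda>_. val (root \<Phi>)"] exI[of _ "\<lambda>_ _. 1"])
       (simp add: spn_output_eq_val)
qed

end

section \<open>Disjoint triangles with edges of both colours\<close>

text \<open>Colour the arcs in \<open>R\<close> red and those in \<open>B\<close> blue. Given a red arc \<open>ab\<close> and a blue
  arc \<open>cd\<close>, the path \<open>abc\<close> or \<open>bcd\<close> is mixed, depending on the colour of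
  \<open>bc\<close>; if \<open>b = c\<close>, then \<open>abd\<close> is.\<close>

lemma card_mixed_paths:
  fixes R B :: "('v \<times> 'v) set"
  assumes V: "finite V" and RB: "R \<subseteq> V \<times> V" "B \<subseteq> V \<times> V"
    and total: "\<And>a b. a \<in> V \<Longrightarrow> b \<in> V \<Longrightarrow> a \<noteq> b \<Longrightarrow> (a, b) \<in> R \<union> B"
  defines "Q \<equiv> {(x, y, z). (x, y) \<in> R \<and> (y, z) \<in> B}"
  shows "card R * card B \<le> (2 * card V + 1) * card Q"
proof -
  have "Q \<subseteq> V \<times> V \<times> V" using RB by (auto simp: Q_def)
  then have Q: "finite Q" using V by (meson finite_SigmaI finite_subset)
  \<comment> \<open>Each map rebuilds a pair of arcs from a mixed path: \<open>bcd\<close> with the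
    extra vertex \<open>a\<close>, \<open>abc\<close> with the extra vertex \<open>d\<close>, or
    \<open>abd\<close> when \<open>b = c\<close>. Two maps on \<open>Q \<times> V\<close> and one on
    \<open>Q\<close> give the factor \<open>2 * card V + 1\<close>.\<close>
  let ?F1 = "(\<lambda>((b, c, d), a). ((a, b), (c, d))) ` (Q \<times> V)"
  let ?F2 = "(\<lambda>((a, b, c), d). ((a, b), (c, d))) ` (Q \<times> V)"
  let ?F3 = "(\<lambda>(a, b, d). ((a, b), (b, d))) ` Q"
  have "R \<times> B \<subseteq> (?F1 \<union> ?F2) \<union> ?F3"
  proof clarify
    fix a b c d
    assume *: "(a, b) \<in> R" "(c, d) \<in> B"
      "((a, b), (c, d)) \<notin> ?F3" "((a, b), (c, d)) \<notin> ?F2"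
    then have V: "a \<in> V" "b \<in> V" "c \<in> V" "d \<in> V" using RB by auto
    have "b \<noteq> c"
    proof
      assume "b = c"
      then have "(a, b, d) \<in> Q" using * by (auto simp: Q_def)
      then show False using *(3) \<open>b = c\<close> by force
    qed
    moreover have "(b, c) \<notin> B"
    proof
      assume "(b, c) \<in> B"
      then have "(a, b, c) \<in> Q" using * by (auto simp: Q_def)
      then show False using *(4) V by force
    qed
    ultimately have "(b, c, d) \<in> Q" using * total V by (auto simp: Q_def)
    then show "((a, b), (c, d)) \<in> ?F1" using V by force
  qed
  then have "card (R \<times> B) \<le> card ((?F1 \<union> ?F2) \<union> ?F3)"
    using Q V by (intro card_mono) auto
  also have "\<dots> \<le> card (?F1 \<union> ?F2) + card ?F3" by (rule card_Un_le)
  also have "\<dots> \<le> (card ?F1 + card ?F2) + card ?F3" using card_Un_le add_right_mono by blast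
  also have "\<dots> \<le> (card (Q \<times> V) + card (Q \<times> V)) + card Q"
    using Q V by (intro add_mono card_image_le) auto
  finally show ?thesis by (simp add: card_cartesian_product algebra_simps)
qed

section \<open>Density and greedy choice of mixed triples\<close>

definition triples :: "'v set \<Rightarrow> ('v \<times> 'v \<times> 'v) set" where
  "triples V = {(x, y, z). x \<in> V \<and> y \<in> V \<and> z \<in> V \<and> x \<noteq> y \<and> y \<noteq> z \<and> x \<noteq> z}"

lemma finite_triples: "finite V \<Longrightarrow> finite (triples V)"
  by (rule finite_subset[of _ "V \<times> V \<times> V"]) (auto simp: triples_def)

lemma card_triples_le: "finite V \<Longrightarrow> card (triples V) \<le> card V ^ 3"
proof -
  assume "finite V"
  then have "card (triples V) \<le> card (V \<times> V \<times> V)"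
    by (intro card_mono) (auto simp: triples_def)
  then show ?thesis by (simp add: card_cartesian_product power3_eq_cube mult.assoc)
qed

text \<open>For \<open>m \<ge> 20\<close> each colour has at least \<open>0.95 / 3 * m^2\<close>
  arcs, and deleting the vertices outside \<open>V\<close> destroys at most
  \<open>0.03 * m^2\<close> of them. So at least \<open>0.28 * m^2\<close> arcs of each colour
  survive, and \<open>card_mixed_paths\<close> with \<open>2 * m + 1 \<le> 3 * m\<close> gives at
  least \<open>0.0784 / 3 * m^3\<close> mixed paths, more than a fiftieth of all triples.\<close>

lemma many_mixed_triples:
  fixes R B :: "(nat \<times> nat) set"
  assumes m: "20 \<le> m" and V: "V \<subseteq> {1..m}" "card ({1..m} - V) \<le> 3 * (m div 200)"
    and R: "R \<subseteq> {1..m} \<times> {1..m}" "m * (m - 1) \<le> 3 * card R"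
    and B: "B \<subseteq> {1..m} \<times> {1..m}" "m * (m - 1) \<le> 3 * card B"
    and irrefl: "irrefl R" "irrefl B" and disj: "R \<inter> B\<inverse> = {}"
    and total: "\<And>a b. a \<in> {1..m} \<Longrightarrow> b \<in> {1..m} \<Longrightarrow> a \<noteq> b \<Longrightarrow> (a, b) \<in> R \<union> B"
  shows "card (triples V) \<le> 50 * card (triples V \<inter> {(x, y, z). (x, y) \<in> R \<and> (y, z) \<in> B})"
proof -
  define W where "W = {1..m} - V"
  have restrict: "real (card (S \<inter> V \<times> V)) \<ge> 28 / 100 * real m ^ 2"
    if S: "S \<subseteq> {1..m} \<times> {1..m}" "m * (m - 1) \<le> 3 * card S" for S
  proof -
    have fin: "finite S" "finite W" using S(1) finite_subset by (auto simp: W_def)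
    have "card (S - V \<times> V) \<le> card (W \<times> {1..m} \<union> {1..m} \<times> W)"
      using S(1) fin by (intro card_mono) (auto simp: W_def)
    also have "\<dots> \<le> card (W \<times> {1..m}) + card ({1..m} \<times> W)" by (rule card_Un_le)
    also have "\<dots> = 2 * m * card W" by (simp add: card_cartesian_product)
    also have "\<dots> \<le> 2 * m * (3 * (m div 200))" using V(2) by (simp add: W_def)
    finally have "real (card (S - V \<times> V)) \<le> real (2 * m * (3 * (m div 200)))"
      by (rule of_nat_mono)
    also have "\<dots> = 2 * real m * (3 * real (m div 200))" by simp
    also have "\<dots> \<le> 2 * real m * (3 * (real m / 200))"
      using of_nat_div_le_of_nat[of m 200, where ?'a = real] by (intro mult_left_mono) auto
    also have "\<dots> = 3 / 100 * real m ^ 2" by (simp add: power2_eq_square)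
    finally have *: "real (card (S - V \<times> V)) \<le> 3 / 100 * real m ^ 2" .
    have "card S = card (S \<inter> V \<times> V) + card (S - V \<times> V)"
      using card_Int_Diff[OF fin(1), of "V \<times> V"] by simp
    then have "real (card S) = real (card (S \<inter> V \<times> V)) + real (card (S - V \<times> V))" by simp
    moreover have "real m * (real m - 1) \<le> 3 * real (card S)"
    proof -
      have "real (m * (m - 1)) \<le> real (3 * card S)" using S(2) of_nat_le_iff by blast
      then show ?thesis using m by (simp add: of_nat_diff)
    qed
    moreover have "real m * (real m - 1) \<ge> 95 / 100 * real m ^ 2"
    proof -
      have "20 * real m \<le> real m * real m" using m by (intro mult_right_mono) auto
      then show ?thesis by (simp add: power2_eq_square algebra_simps)
    qed
    ultimately show ?thesis using * by simp
  qed
  define Q where "Q = {(x, y, z). (x, y) \<in> R \<inter> V \<times> V \<and> (y, z) \<in> B \<inter> V \<times> V}"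
  have finV: "finite V" using V(1) finite_subset by blast
  have cardV: "card V \<le> m" using card_mono[OF _ V(1)] by simp
  have "card (R \<inter> V \<times> V) * card (B \<inter> V \<times> V) \<le> (2 * card V + 1) * card Q"
    unfolding Q_def
  proof (rule card_mixed_paths[OF finV])
    fix a b assume ab: "a \<in> V" "b \<in> V" "a \<noteq> b"
    then have "a \<in> {1..m}" "b \<in> {1..m}" using V(1) by blast+
    then show "(a, b) \<in> R \<inter> V \<times> V \<union> B \<inter> V \<times> V" using total ab by blast
  qed auto
  also have "\<dots> \<le> (2 * m + 1) * card Q" using cardV by simp
  finally have "real (card (R \<inter> V \<times> V) * card (B \<inter> V \<times> V)) \<le> real ((2 * m + 1) * card Q)"
    by (rule of_nat_mono)
  then have *: "real (card (R \<inter> V \<times> V)) * real (card (B \<inter> V \<times> V)) \<le> (2 * real m + 1) * real (card Q)"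
    by (simp add: algebra_simps)
  have "784 / 10000 * (real m ^ 3 * real m) = (28 / 100 * real m ^ 2) * (28 / 100 * real m ^ 2)"
    by (simp add: power2_eq_square power3_eq_cube)
  also have "\<dots> \<le> real (card (R \<inter> V \<times> V)) * real (card (B \<inter> V \<times> V))"
    using restrict[OF R] restrict[OF B] by (intro mult_mono) auto
  also have "\<dots> \<le> (2 * real m + 1) * real (card Q)" by (rule *)
  also have "\<dots> \<le> (3 * real m) * real (card Q)"
    using m by (intro mult_right_mono) auto
  finally have "real m * (784 / 10000 * real m ^ 3) \<le> real m * (3 * real (card Q))"
    by (simp add: mult_ac)
  then have "784 / 10000 * real m ^ 3 \<le> 3 * real (card Q)"
    using m by (subst (asm) mult_le_cancel_left_pos) auto
  moreover have "0 \<le> real m ^ 3" by simp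
  ultimately have "real m ^ 3 \<le> 50 * real (card Q)" by linarith
  then have "real (m ^ 3) \<le> real (50 * card Q)" by simp
  then have "m ^ 3 \<le> 50 * card Q" by (simp only: of_nat_le_iff)
  moreover have "card (triples V) \<le> m ^ 3"
    by (rule order_trans[OF card_triples_le[OF finV] power_mono[OF cardV]]) simp
  \<comment> \<open>Irreflexivity separates consecutive vertices. The ends differ by
    \<open>disj\<close>: an edge is not red in one direction and blue in the other.\<close>
  moreover have "Q \<subseteq> triples V \<inter> {(x, y, z). (x, y) \<in> R \<and> (y, z) \<in> B}"
    using irrefl disj by (auto simp: Q_def triples_def irrefl_def)
  then have "card Q \<le> card (triples V \<inter> {(x, y, z). (x, y) \<in> R \<and> (y, z) \<in> B})"
    using finite_triples[OF finV] by (intro card_mono) auto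
  ultimately show ?thesis by linarith
qed

definition triple_vertices :: "('v \<times> 'v \<times> 'v) list \<Rightarrow> 'v list" where
  "triple_vertices ts = concat (map (\<lambda>(x, y, z). [x, y, z]) ts)"

lemma triple_vertices_simps [simp]:
  "triple_vertices [] = []"
  "triple_vertices ((x, y, z) # ts) = x # y # z # triple_vertices ts"
  by (simp_all add: triple_vertices_def)

lemma length_triple_vertices: "length (triple_vertices ts) = 3 * length ts"
  by (induction ts) auto

text \<open>The triples are picked greedily: a random triple of unused vertices lowers the total
  weight by the factor \<open>149 / 150\<close> in expectation.\<close>

lemma greedy_disjoint_triples:
  fixes V :: "'v set" and Q :: "'u \<Rightarrow> ('v \<times> 'v \<times> 'v) set"
  assumes "finite V" "finite U"
    and dense: "\<And>V' u. V' \<subseteq> V \<Longrightarrow> card (V - V') \<le> 3 * (t - 1) \<Longrightarrow> u \<in> U \<Longrightarrow>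
       card (triples V') \<le> 50 * card (triples V' \<inter> Q u)"
    and nonempty: "\<And>V'. V' \<subseteq> V \<Longrightarrow> card (V - V') \<le> 3 * (t - 1) \<Longrightarrow> triples V' \<noteq> {}"
  shows "\<exists>ts. length ts = t \<and> distinct (triple_vertices ts) \<and> set (triple_vertices ts) \<subseteq> V \<and>
     (\<Sum>u\<in>U. prod_list (map (\<lambda>\<tau>. if \<tau> \<in> Q u then 2 / 3 else 1) ts)) \<le> real (card U) * (149 / 150) ^ t"
proof -
  define c :: "'u \<Rightarrow> 'v \<times> 'v \<times> 'v \<Rightarrow> real" where "c = (\<lambda>u \<tau>. if \<tau> \<in> Q u then 2 / 3 else 1)"
  have "\<exists>ts. length ts = l \<and> distinct (triple_vertices ts) \<and> set (triple_vertices ts) \<subseteq> V \<and>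
     (\<Sum>u\<in>U. prod_list (map (c u) ts)) \<le> real (card U) * (149 / 150) ^ l" if "l \<le> t" for l
    using that
  proof (induction l)
    case 0
    show ?case by (intro exI[of _ "[]"]) simp
  next
    case (Suc l)
    then obtain ts where ts: "length ts = l" "distinct (triple_vertices ts)"
      "set (triple_vertices ts) \<subseteq> V"
      "(\<Sum>u\<in>U. prod_list (map (c u) ts)) \<le> real (card U) * (149 / 150) ^ l" by auto
    define V' where "V' = V - set (triple_vertices ts)"
    define A where "A = triples V'"
    have "V - V' = set (triple_vertices ts)" using ts(3) by (auto simp: V'_def)
    then have "card (V - V') = 3 * l"
      using ts by (simp add: distinct_card length_triple_vertices)
    \<comment> \<open>At most \<open>t - 1\<close> triples precede the next one, whence the bound
      \<open>3 * (t - 1)\<close> in the density hypotheses.\<close>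
    then have V': "V' \<subseteq> V" "card (V - V') \<le> 3 * (t - 1)"
      using Suc.prems by (auto simp: V'_def)
    have finA: "finite A"
      unfolding A_def by (rule finite_triples[OF finite_subset[OF V'(1) assms(1)]])
    have neA: "A \<noteq> {}" unfolding A_def by (rule nonempty[OF V'])
    define w where "w = (\<lambda>u. prod_list (map (c u) ts))"
    have w_nonneg: "0 \<le> w u" for u
      unfolding w_def by (rule prod_list_nonneg) (auto simp: c_def)
    \<comment> \<open>The factor is \<open>1 - 1/3 * 1/50\<close>: at least a fiftieth of the
      triples lie in \<open>Q u\<close>, and each of these saves a third.\<close>
    have c_sum: "(\<Sum>\<tau>\<in>A. c u \<tau>) \<le> real (card A) * (149 / 150)" if "u \<in> U" for u
    proof -
      have "c u \<tau> = 1 - (if \<tau> \<in> Q u then 1 / 3 else 0)" for \<tau> by (simp add: c_def)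
      then have "(\<Sum>\<tau>\<in>A. c u \<tau>) = real (card A) - (\<Sum>\<tau>\<in>A. if \<tau> \<in> Q u then 1 / 3 else 0)"
        by (simp add: sum_subtractf)
      also have "(\<Sum>\<tau>\<in>A. if \<tau> \<in> Q u then 1 / 3 else 0) = real (card (A \<inter> Q u)) / 3"
        using finA by (simp add: sum.inter_restrict[symmetric])
      finally show ?thesis using dense[OF V' that] by (simp add: A_def)
    qed
    \<comment> \<open>Averaging: if every triple did worse, summing over \<open>A\<close> and
      exchanging the sums would contradict \<open>c_sum\<close>.\<close>
    have "\<exists>\<tau>\<in>A. (\<Sum>u\<in>U. c u \<tau> * w u) \<le> (\<Sum>u\<in>U. w u) * (149 / 150)"
    proof (rule ccontr)
      assume "\<not> ?thesis"
      then have "(\<Sum>\<tau>\<in>A. (\<Sum>u\<in>U. w u) * (149 / 150)) < (\<Sum>\<tau>\<in>A. \<Sum>u\<in>U. c u \<tau> * w u)"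
        using finA neA by (intro sum_strict_mono) auto
      also have "\<dots> = (\<Sum>u\<in>U. (\<Sum>\<tau>\<in>A. c u \<tau>) * w u)"
        by (subst sum.swap) (simp add: sum_distrib_right)
      also have "\<dots> \<le> (\<Sum>u\<in>U. (real (card A) * (149 / 150)) * w u)"
        using c_sum w_nonneg by (intro sum_mono mult_right_mono) auto
      also have "\<dots> = (\<Sum>\<tau>\<in>A. (\<Sum>u\<in>U. w u) * (149 / 150))"
        by (simp add: sum_distrib_left sum_distrib_right mult_ac)
      finally show False by simp
    qed
    then obtain \<tau> where \<tau>: "\<tau> \<in> A" "(\<Sum>u\<in>U. c u \<tau> * w u) \<le> (\<Sum>u\<in>U. w u) * (149 / 150)"
      by blast
    have "(\<Sum>u\<in>U. prod_list (map (c u) (\<tau> # ts))) \<le> (\<Sum>u\<in>U. w u) * (149 / 150)"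
      using \<tau>(2) by (simp add: w_def)
    also have "\<dots> \<le> (real (card U) * (149 / 150) ^ l) * (149 / 150)"
      using ts(4) by (intro mult_right_mono) (auto simp: w_def)
    finally have "(\<Sum>u\<in>U. prod_list (map (c u) (\<tau> # ts))) \<le> real (card U) * (149 / 150) ^ Suc l"
      by simp
    moreover obtain x y z where "\<tau> = (x, y, z)" by (cases \<tau>)
    ultimately show ?case
      using \<tau>(1) ts by (intro exI[of _ "\<tau> # ts"]) (auto simp: A_def triples_def V'_def)
  qed
  then show ?thesis unfolding c_def by blast
qed

section \<open>Spanning trees with prescribed patterns\<close>

lemma cyclic_predecessor:
  assumes "pcas u p u" "i < length p"
  shows "fst (p ! i) = snd (p ! (if i = 0 then length p - 1 else i - 1))"
proof -
  have "pcas u p v \<Longrightarrow> i < length p \<Longrightarrow> fst (p ! i) = (if i = 0 then u else snd (p ! (i - 1)))"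
    for u v i and p :: "('a \<times> 'a) list"
    by (induction p arbitrary: u i) (auto simp: nth_Cons')
  moreover have "pcas u p v \<Longrightarrow> p \<noteq> [] \<Longrightarrow> snd (p ! (length p - 1)) = v"
    for u v and p :: "('a \<times> 'a) list"
    by (induction p arbitrary: u) (auto simp: nth_Cons')
  ultimately show ?thesis using assms by (auto simp: gr_implies_not0)
qed

text \<open>A vertex of maximal depth on a long cycle would have two lower neighbours.\<close>

lemma no_long_cycle:
  fixes \<delta> :: "'v \<Rightarrow> nat"
  assumes "pre_digraph.cycle (with_proj G) p" "3 \<le> length p"
    and depth: "\<And>a b. (a, b) \<in> parcs G \<Longrightarrow> \<delta> a \<noteq> \<delta> b"
    and unique: "\<And>a v b. (a, v) \<in> parcs G \<Longrightarrow> (v, b) \<in> parcs G \<Longrightarrow> \<delta> a < \<delta> v \<Longrightarrow> \<delta> b < \<delta> v \<Longrightarrow> a = b"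
  shows False
proof -
  obtain u where p: "set p \<subseteq> parcs G" "pcas u p u" "distinct (tl (pawalk_verts u p))"
    using assms(1) by (auto simp: pre_digraph.cycle_def pre_digraph.awalk_def cas_with_proj_eq
        awalk_verts_with_proj_eq)
  have "pcas u p v \<Longrightarrow> tl (pawalk_verts u p) = map snd p" for u v
  proof (induction p arbitrary: u)
    case (Cons a p)
    then show ?case by (cases p) auto
  qed simp
  \<comment> \<open>The heads of the arcs list every vertex of the cycle exactly once.\<close>
  then have dist: "distinct (map snd p)" using p(2,3) by metis
  define L where "L = length p"
  have L: "3 \<le> L" using assms(2) by (simp add: L_def)
  obtain i where i: "i < L" "\<And>j. j < L \<Longrightarrow> \<delta> (snd (p ! j)) \<le> \<delta> (snd (p ! i))"
  proof -
    let ?D = "(\<lambda>j. \<delta> (snd (p ! j))) ` {..<L}"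
    have "Max ?D \<in> ?D" using L by (intro Max_in) (auto simp: lessThan_empty_iff)
    then obtain i where "i < L" "Max ?D = \<delta> (snd (p ! i))" by auto
    then show thesis using that[of i] Max_ge[of ?D] by auto
  qed
  \<comment> \<open>\<open>j\<close> and \<open>i'\<close> are the cyclic neighbours of position
    \<open>i\<close>: arc \<open>i\<close> enters the deepest vertex from the head of arc
    \<open>j\<close>, and arc \<open>i'\<close> leaves it. Length at least 3 keeps the two positions
    apart.\<close>
  define j where "j = (if i = 0 then L - 1 else i - 1)"
  define i' where "i' = (if i = L - 1 then 0 else i + 1)"
  have jL: "j < L" "i' < L" "j \<noteq> i'" using L i(1) by (auto simp: j_def i'_def)
  have pj: "fst (p ! i) = snd (p ! j)"
    using cyclic_predecessor[OF p(2), of i] i(1) by (simp add: j_def L_def)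
  have pi': "fst (p ! i') = snd (p ! i)"
    using cyclic_predecessor[OF p(2), of i'] jL(2) i(1) by (auto simp: i'_def L_def split: if_splits)
  have "p ! i = (snd (p ! j), snd (p ! i))" "p ! i' = (snd (p ! i), snd (p ! i'))"
    using pj pi' by (auto simp: prod_eq_iff)
  then have arcs: "(snd (p ! j), snd (p ! i)) \<in> parcs G" "(snd (p ! i), snd (p ! i')) \<in> parcs G"
    using p(1) i(1) jL(2) nth_mem[of _ p] unfolding L_def by (metis subsetD)+
  have "snd (p ! j) = snd (p ! i')"
    using unique[OF arcs] depth[OF arcs(1)] depth[OF arcs(2)] i(2)[OF jL(1)] i(2)[OF jL(2)] by simp
  then show False
    using dist jL nth_eq_iff_index_eq[OF dist, of j i'] by (simp add: L_def)
qed

lemma triangle_not_undirected_tree: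
  assumes "(a, b) \<in> parcs G" "(b, c) \<in> parcs G" "(c, a) \<in> parcs G"
    and "a \<in> pverts G" "a \<noteq> b" "b \<noteq> c" "a \<noteq> c"
  shows "\<not> undirected_tree (with_proj G)"
proof -
  have "pre_digraph.cycle (with_proj G) [(a, b), (b, c), (c, a)]"
    unfolding pre_digraph.cycle_def pre_digraph.awalk_def cas_with_proj_eq awalk_verts_with_proj_eq
    using assms by (intro exI[of _ a]) auto
  then show ?thesis by (force simp: undirected_tree_def)
qed

text \<open>Following parents lowers \<open>\<delta>\<close> until \<open>r\<close> is reached, so
  the graph is connected. The only neighbour of smaller \<open>\<delta>\<close> is the parent, so
  \<open>no_long_cycle\<close> applies.\<close>

lemma parent_graph_undirected_tree:
  fixes \<delta> :: "'v \<Rightarrow> nat"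
  assumes "r \<in> V" and par: "\<And>v. v \<in> V - {r} \<Longrightarrow> par v \<in> V \<and> \<delta> (par v) < \<delta> v"
    and G: "pverts G = V" "parcs G = {(a, b). \<exists>v\<in>V - {r}. {a, b} = {v, par v}}"
  shows "undirected_tree (with_proj G)"
proof -
  let ?R = "rtrancl_on V (parcs G)"
  have sym: "(a, b) \<in> parcs G \<Longrightarrow> (b, a) \<in> parcs G" for a b
    using G by (simp add: insert_commute)
  have "v \<in> V \<Longrightarrow> (v, r) \<in> ?R \<and> (r, v) \<in> ?R" for v
  proof (induction "\<delta> v" arbitrary: v rule: less_induct)
    case less
    show ?case
    proof (cases "v = r")
      case False
      with less.prems have v: "v \<in> V - {r}" by simp
      then have IH: "(par v, r) \<in> ?R" "(r, par v) \<in> ?R" using less.hyps par by auto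
      have arc: "(v, par v) \<in> parcs G" using v G(2) by auto
      then have "(v, par v) \<in> ?R" "(par v, v) \<in> ?R"
        using sym par[OF v] less.prems by (auto intro: rtrancl_on_into_rtrancl_on)
      then show ?thesis using IH rtrancl_on_trans by metis
    qed (use assms(1) in auto)
  qed
  then have "(u, v) \<in> ?R" if "u \<in> V" "v \<in> V" for u v
    using that rtrancl_on_trans by metis
  moreover have "mk_symmetric (with_proj G) = \<lparr>pverts = V, parcs = parcs G\<rparr>"
    unfolding mk_symmetric_def using G(1) sym by auto
  ultimately have "Digraph_Component.connected (with_proj G)"
    using assms(1) by (auto simp: connected_def strongly_connected_def reachable_def)
  moreover have "\<not> (pre_digraph.cycle (with_proj G) p \<and> 3 \<le> length p)" for p
  proof
    assume *: "pre_digraph.cycle (with_proj G) p \<and> 3 \<le> length p"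
    \<comment> \<open>In an edge between \<open>v\<close> and \<open>par v\<close> the end with
      larger \<open>\<delta>\<close> must be \<open>v\<close>.\<close>
    have lower: "b = par a" if "(a, b) \<in> parcs G" "\<delta> b < \<delta> a" for a b
      using that par unfolding G(2) by (auto simp: doubleton_eq_iff dest: less_asym')
    have "\<delta> a \<noteq> \<delta> b" if "(a, b) \<in> parcs G" for a b
    proof -
      obtain v where v: "v \<in> V - {r}" "{a, b} = {v, par v}" using \<open>(a, b) \<in> parcs G\<close> G(2) by auto
      then show ?thesis using par[OF v(1)] by (auto simp: doubleton_eq_iff)
    qed
    then show False
      using no_long_cycle[OF conjunct1[OF *] conjunct2[OF *], of \<delta>] lower sym by metis
  qed
  ultimately show ?thesis by (simp add: undirected_tree_def)
qed

section \<open>Trees encoded by patterns on disjoint triples\<close>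

text \<open>Patterns \<open>0\<close>, \<open>1\<close>, \<open>2\<close> at a triple \<open>(x, y, z)\<close> omit the edge \<open>xy\<close>, \<open>xz\<close>, \<open>yz\<close>
  respectively from the triangle; the vertex \<open>x\<close> and all vertices outside the triples
  are attached to the centre \<open>w\<close>.\<close>

fun parent :: "'v \<Rightarrow> ('v \<times> 'v \<times> 'v) list \<Rightarrow> ('v \<times> 'v \<times> 'v \<Rightarrow> nat) \<Rightarrow> 'v \<Rightarrow> 'v" where
  "parent w [] c v = w"
| "parent w ((x, y, z) # ts) c v =
     (if v = y then if c (x, y, z) = 0 then z else x
      else if v = z then if c (x, y, z) = 1 then y else x
      else parent w ts c v)"

text \<open>For disjoint triples avoiding \<open>w\<close> this is the distance to \<open>w\<close>
  along \<open>parent\<close>. The value 3 belongs to the vertex that hangs from the other non-root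
  vertex of its triple instead of from \<open>x\<close>.\<close>

fun depth :: "'v \<Rightarrow> ('v \<times> 'v \<times> 'v) list \<Rightarrow> ('v \<times> 'v \<times> 'v \<Rightarrow> nat) \<Rightarrow> 'v \<Rightarrow> nat" where
  "depth w [] c v = (if v = w then 0 else 1)"
| "depth w ((x, y, z) # ts) c v =
     (if v = y then if c (x, y, z) = 0 then 3 else 2
      else if v = z then if c (x, y, z) = 1 then 3 else 2
      else depth w ts c v)"

lemma depth_outside: "v \<notin> set (triple_vertices ts) \<Longrightarrow> depth w ts c v = (if v = w then 0 else 1)"
  by (induction w ts c v rule: depth.induct) auto

lemma parent_in: "parent w ts c v \<in> insert w (set (triple_vertices ts))"
  by (induction w ts c v rule: parent.induct) auto

text \<open>The parent of a vertex of \<open>ts\<close> is \<open>w\<close> or again in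
  \<open>ts\<close>, so by distinctness the clauses for the head triple do not interfere with the
  tail. Within the head triple, \<open>x\<close> has depth 1 as it lies outside the tail.\<close>

lemma depth_parent:
  assumes "distinct (triple_vertices ts)" "w \<notin> set (triple_vertices ts)" "v \<noteq> w"
  shows "depth w ts c (parent w ts c v) < depth w ts c v"
  using assms
proof (induction w ts c v rule: parent.induct)
  case (2 w x y z ts c v)
  then show ?case using parent_in[of w ts c v] by (auto simp: depth_outside)
qed auto

text \<open>Translates patterns into edges: each pattern keeps the two triangle edges that it does
  not omit. The edge \<open>yz\<close> is directed from \<open>y\<close> to \<open>z\<close> under
  pattern 0 and from \<open>z\<close> to \<open>y\<close> under pattern 1, hence the
  disjunction.\<close>

lemma parent_in_triple:
  assumes "distinct (triple_vertices ts)" "(x, y, z) \<in> set ts"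
  shows "c (x, y, z) \<noteq> 0 \<Longrightarrow> parent w ts c y = x"
    and "c (x, y, z) \<noteq> 1 \<Longrightarrow> parent w ts c z = x"
    and "c (x, y, z) \<noteq> 2 \<Longrightarrow> c (x, y, z) \<in> {0, 1, 2} \<Longrightarrow> parent w ts c y = z \<or> parent w ts c z = y"
proof -
  have mem: "(x, y, z) \<in> set ts \<Longrightarrow> x \<in> set (triple_vertices ts) \<and> y \<in> set (triple_vertices ts) \<and>
      z \<in> set (triple_vertices ts)" for ts
    by (force simp: triple_vertices_def)
  have "(c (x, y, z) \<noteq> 0 \<longrightarrow> parent w ts c y = x) \<and> (c (x, y, z) \<noteq> 1 \<longrightarrow> parent w ts c z = x) \<and>
    (c (x, y, z) \<noteq> 2 \<and> c (x, y, z) \<in> {0, 1, 2} \<longrightarrow> parent w ts c y = z \<or> parent w ts c z = y)"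
    using assms
  proof (induction ts)
    case (Cons a ts)
    obtain x' y' z' where a: "a = (x', y', z')" by (cases a)
    show ?case
    proof (cases "(x, y, z) \<in> set ts")
      case True
      then show ?thesis using Cons mem[OF True] by (auto simp: a)
    next
      case False
      with Cons show ?thesis by (auto simp: a)
    qed
  qed simp
  then show "c (x, y, z) \<noteq> 0 \<Longrightarrow> parent w ts c y = x"
    and "c (x, y, z) \<noteq> 1 \<Longrightarrow> parent w ts c z = x"
    and "c (x, y, z) \<noteq> 2 \<Longrightarrow> c (x, y, z) \<in> {0, 1, 2} \<Longrightarrow> parent w ts c y = z \<or> parent w ts c z = y"
    by blast+
qed

definition tree_edges ::
    "nat \<Rightarrow> nat \<Rightarrow> (nat \<times> nat \<times> nat) list \<Rightarrow> (nat \<times> nat \<times> nat \<Rightarrow> nat) \<Rightarrow> nat set set" where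
  "tree_edges m w ts c = {{v, parent w ts c v} |v. v \<in> {1..m} - {w}}"

definition tree_vector ::
    "nat \<Rightarrow> nat \<Rightarrow> (nat \<Rightarrow> nat set) \<Rightarrow> nat \<Rightarrow> (nat \<times> nat \<times> nat) list \<Rightarrow>
     (nat \<times> nat \<times> nat \<Rightarrow> nat) \<Rightarrow> nat \<Rightarrow> real" where
  "tree_vector m n e w ts c = (\<lambda>i\<in>{1..n}. if e i \<in> tree_edges m w ts c then 1 else 0)"

lemma undirected_edges_complete:
  "undirected_edges (complete_pair_graph m) = {{u, v} |u v. u \<in> {1..m} \<and> v \<in> {1..m} \<and> u \<noteq> v}"
  by (auto simp: undirected_edges_def complete_pair_graph_def)

lemma spanning_graph_of:
  assumes "bij_betw e {1..n} (undirected_edges (complete_pair_graph m))"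
  shows "spanning (with_proj (graph_of m n e x)) (with_proj (complete_pair_graph m))"
proof -
  have sub: "parcs (graph_of m n e x) \<subseteq> parcs (complete_pair_graph m)"
  proof clarify
    fix u v assume "(u, v) \<in> parcs (graph_of m n e x)"
    then obtain i where "i \<in> {1..n}" "e i = {u, v}" by (auto simp: graph_of_def)
    then have "{u, v} \<in> undirected_edges (complete_pair_graph m)"
      using bij_betwE[OF assms] by metis
    then show "(u, v) \<in> parcs (complete_pair_graph m)"
      by (auto simp: undirected_edges_def complete_pair_graph_def doubleton_eq_iff)
  qed
  have ends: "a \<in> {1..m} \<and> b \<in> {1..m}" if "(a, b) \<in> parcs (graph_of m n e x)" for a b
    using subsetD[OF sub that] by (auto simp: complete_pair_graph_def)
  have verts: "pverts (graph_of m n e x) = {1..m}" by (simp add: graph_of_def)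
  have "wf_digraph (with_proj (complete_pair_graph m))"
    by unfold_locales (auto simp: complete_pair_graph_def)
  moreover have "wf_digraph (with_proj (graph_of m n e x))"
    by unfold_locales (use ends verts in force)+
  ultimately show ?thesis using sub
    by (auto simp: spanning_def subgraph_def compatible_def graph_of_def complete_pair_graph_def)
qed

text \<open>Surjectivity of \<open>e\<close> gives every parent edge an index, so the graph of the
  vector is exactly the parent graph, and \<open>depth\<close> decreases along parents.\<close>

lemma tree_vector_spanning:
  assumes e: "bij_betw e {1..n} (undirected_edges (complete_pair_graph m))"
    and ts: "distinct (triple_vertices ts)" "set (triple_vertices ts) \<subseteq> {1..m}"
    and w: "w \<in> {1..m}" "w \<notin> set (triple_vertices ts)"
  shows "tree_vector m n e w ts c \<in> spanning_tree_vectors m n e"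
proof -
  let ?G = "graph_of m n e (tree_vector m n e w ts c)"
  have par: "parent w ts c v \<in> {1..m} \<and> depth w ts c (parent w ts c v) < depth w ts c v"
    if "v \<in> {1..m} - {w}" for v
    using parent_in[of w ts c v] depth_parent[OF ts(1) w(2), of v c] that ts(2) w(1) by auto
  have "tree_edges m w ts c \<subseteq> undirected_edges (complete_pair_graph m)"
  proof
    fix E assume "E \<in> tree_edges m w ts c"
    then obtain v where v: "v \<in> {1..m} - {w}" "E = {v, parent w ts c v}"
      by (auto simp: tree_edges_def)
    then have "parent w ts c v \<in> {1..m}" "v \<noteq> parent w ts c v" using par[OF v(1)] by auto
    then show "E \<in> undirected_edges (complete_pair_graph m)"
      unfolding undirected_edges_complete using v by blast
  qed
  then have "E \<in> tree_edges m w ts c \<Longrightarrow> \<exists>i\<in>{1..n}. e i = E" for E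
    using bij_betw_imp_surj_on[OF e] by (metis imageE subsetD)
  then have "parcs ?G = {(a, b). {a, b} \<in> tree_edges m w ts c}"
    by (auto simp: graph_of_def tree_vector_def split: if_splits) metis
  then have "parcs ?G = {(a, b). \<exists>v\<in>{1..m} - {w}. {a, b} = {v, parent w ts c v}}"
    by (auto simp: tree_edges_def)
  then have "undirected_tree (with_proj ?G)"
    using par w(1)
    by (intro parent_graph_undirected_tree[where \<delta> = "depth w ts c" and par = "parent w ts c"])
       (auto simp: graph_of_def)
  then show ?thesis
    using spanning_graph_of[OF e]
    by (auto simp: spanning_tree_vectors_def undirected_spanning_tree_def tree_vector_def)
qed

lemma spanning_tree_vector_no_triangle:
  assumes "X \<in> spanning_tree_vectors m n e"
    and "i \<in> {1..n}" "X i = 1" "e i = {x, y}"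
    and "j \<in> {1..n}" "X j = 1" "e j = {y, z}"
    and "k \<in> {1..n}" "X k = 1" "e k = {x, z}"
    and "x \<in> {1..m}" "x \<noteq> y" "y \<noteq> z" "x \<noteq> z"
  shows False
proof -
  have "(x, y) \<in> parcs (graph_of m n e X)" "(y, z) \<in> parcs (graph_of m n e X)"
    "(z, x) \<in> parcs (graph_of m n e X)"
    using assms(2-10) by (auto simp: graph_of_def insert_commute)
  then have "\<not> undirected_tree (with_proj (graph_of m n e X))"
    using assms(11-) triangle_not_undirected_tree[where a = x and b = y and c = z]
    by (simp add: graph_of_def)
  then show False
    using assms(1) by (simp add: spanning_tree_vectors_def undirected_spanning_tree_def)
qed

text \<open>The exchange operation behind rectangles. Mixes of two members of a rectangle are only
  required to be spanning trees, not members of the rectangle.\<close>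

definition mix :: "nat set \<Rightarrow> (nat \<Rightarrow> real) \<Rightarrow> (nat \<Rightarrow> real) \<Rightarrow> nat \<Rightarrow> real" where
  "mix Y x x' = (\<lambda>i. if i \<in> Y then x i else x' i)"

text \<open>If both edges of a triangle lying on one side of the partition occur in one tree of
  the rectangle, then the third edge, which lies on the other side, occurs in no tree
  of it.\<close>

lemma rectangle_restricts_pattern:
  assumes e: "bij_betw e {1..n} (undirected_edges (complete_pair_graph m))"
    and ts: "distinct (triple_vertices ts)" "set (triple_vertices ts) \<subseteq> {1..m}"
    and w: "w \<in> {1..m}" "w \<notin> set (triple_vertices ts)"
    and rect: "\<forall>X\<in>R. \<forall>X'\<in>R. mix Y X X' \<in> spanning_tree_vectors m n e"
    and \<tau>: "(x, y, z) \<in> set ts"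
    and i: "i \<in> {1..n}" "i \<in> Y" "e i = {x, y}"
    and j: "j \<in> {1..n}" "j \<notin> Y" "e j = {y, z}"
  shows "\<exists>A\<subseteq>{0, 1, 2}. card A \<le> 2 \<and>
    (\<forall>c\<in>set ts \<rightarrow>\<^sub>E {0, 1, 2}. tree_vector m n e w ts c \<in> R \<longrightarrow> c (x, y, z) \<in> A)"
proof -
  define vec where "vec = tree_vector m n e w ts"
  have mem: "x \<in> set (triple_vertices ts)" "y \<in> set (triple_vertices ts)"
    "z \<in> set (triple_vertices ts)" using \<tau> by (force simp: triple_vertices_def)+
  then have V: "x \<in> {1..m} - {w}" "y \<in> {1..m} - {w}" "z \<in> {1..m} - {w}" using ts(2) w(2) by auto
  have dist: "x \<noteq> y" "y \<noteq> z" "x \<noteq> z"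
    using split_list[OF \<tau>] ts(1) by (auto simp: triple_vertices_def)
  have "{x, z} \<in> undirected_edges (complete_pair_graph m)"
    unfolding undirected_edges_complete using V dist by blast
  then obtain k where k: "k \<in> {1..n}" "e k = {x, z}"
    using bij_betw_imp_surj_on[OF e] by (metis imageE)
  have edge: "{v, parent w ts c v} \<in> tree_edges m w ts c" if "v \<in> {1..m} - {w}" for v c
    using that by (auto simp: tree_edges_def)
  have vec_i: "vec c i = 1" if "c (x, y, z) \<noteq> 0" for c
    using edge[OF V(2), of c] parent_in_triple(1)[where c = c, OF ts(1) \<tau> that] i
    by (simp add: vec_def tree_vector_def insert_commute)
  have vec_k: "vec c k = 1" if "c (x, y, z) \<noteq> 1" for c
    using edge[OF V(3), of c] parent_in_triple(2)[where c = c, OF ts(1) \<tau> that] k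
    by (simp add: vec_def tree_vector_def insert_commute)
  have vec_j: "vec c j = 1" if "c (x, y, z) \<noteq> 2" "c \<in> set ts \<rightarrow>\<^sub>E {0, 1, 2}" for c
  proof -
    have "c (x, y, z) \<in> {0, 1, 2}" using that(2) \<tau> by (auto simp: PiE_iff)
    from parent_in_triple(3)[where c = c and w = w, OF ts(1) \<tau> that(1) this] show ?thesis
      using edge[OF V(2), of c] edge[OF V(3), of c] j
      by (auto simp: vec_def tree_vector_def insert_commute)
  qed
  have no: False
    if "vec c \<in> R" "vec c' \<in> R" "mix Y (vec c) (vec c') i = 1" "mix Y (vec c) (vec c') j = 1"
      "mix Y (vec c) (vec c') k = 1" for c c'
    using spanning_tree_vector_no_triangle[OF rect[rule_format, OF that(1,2)] i(1) that(3) i(3) j(1) that(4) j(3)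
        k(1) that(5) k(2)] V dist by auto
  let ?C = "set ts \<rightarrow>\<^sub>E {0, 1, 2 :: nat}"
  \<comment> \<open>\<open>b\<close> is the pattern that omits the edge lying alone on its side:
    \<open>yz\<close> if \<open>xz\<close> is in \<open>Y\<close> together with \<open>xy\<close>,
    and \<open>xy\<close> otherwise. Every other pattern contains that edge, so mixing it with
    \<open>b\<close> would close the triangle.\<close>
  define b :: nat where "b = (if k \<in> Y then 2 else 0)"
  have no_b: False if "vec c \<in> R" "vec c' \<in> R" "c \<in> ?C" "c' \<in> ?C"
    "c (x, y, z) = b" "c' (x, y, z) \<noteq> b" for c c'
  proof (cases "k \<in> Y")
    case True
    then show False
      using no[OF that(1,2)] vec_i[of c] vec_k[of c] vec_j[of c'] that(3-) i j
      by (simp add: b_def mix_def)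
  next
    case False
    then show False
      \<comment> \<open>The arguments are swapped because now the lone edge \<open>xy\<close> is on
        the side of \<open>Y\<close>, so \<open>c'\<close> must supply that side.\<close>
      using no[OF that(2,1)] vec_i[of c'] vec_k[of c] vec_j[of c] that(3-) i j
      by (simp add: b_def mix_def)
  qed
  have vals: "c (x, y, z) \<in> {0, 1, 2}" if "c \<in> ?C" for c using that \<tau> by (auto simp: PiE_iff)
  show ?thesis
  \<comment> \<open>Either \<open>b\<close> occurs and is then the only pattern, or it is excluded
    and two patterns remain.\<close>
  proof (cases "\<exists>c\<in>?C. vec c \<in> R \<and> c (x, y, z) = b")
    case True
    then have "\<forall>c\<in>?C. vec c \<in> R \<longrightarrow> c (x, y, z) \<in> {b}" using no_b by blast
    then show ?thesis by (intro exI[of _ "{b}"]) (auto simp: vec_def b_def)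
  next
    case False
    then have "\<forall>c\<in>?C. vec c \<in> R \<longrightarrow> c (x, y, z) \<in> {0, 1, 2} - {b}" using vals by blast
    moreover have "card ({0, 1, 2} - {b}) \<le> 2" by (auto simp: b_def)
    ultimately show ?thesis by (intro exI[of _ "{0, 1, 2} - {b}"]) (auto simp: vec_def)
  qed
qed

section \<open>Covering the spanning trees by rectangles\<close>

lemma distinct_triples: "distinct (triple_vertices ts) \<Longrightarrow> distinct ts"
proof (induction ts)
  case (Cons a ts)
  obtain x y z where "a = (x, y, z)" by (cases a)
  moreover have "(x, y, z) \<in> set ts \<Longrightarrow> x \<in> set (triple_vertices ts)"
    by (force simp: triple_vertices_def)
  ultimately show ?case using Cons by auto
qed simp

text \<open>The patterns lie in a product of sets of size at most 2 or 3. Taking out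
  \<open>3 ^ length ts\<close> leaves the weight that the greedy choice of triples controls.\<close>

lemma card_restricted_patterns:
  fixes P :: "('t \<Rightarrow> nat) set"
  assumes ts: "distinct ts" and P: "P \<subseteq> set ts \<rightarrow>\<^sub>E {0, 1, 2}"
    and Q: "\<And>\<tau>. \<tau> \<in> set ts \<Longrightarrow> \<tau> \<in> Q \<Longrightarrow> \<exists>A\<subseteq>{0, 1, 2}. card A \<le> 2 \<and> (\<forall>c\<in>P. c \<tau> \<in> A)"
  shows "real (card P) \<le> 3 ^ length ts * prod_list (map (\<lambda>\<tau>. if \<tau> \<in> Q then 2 / 3 else 1) ts)"
proof -
  have "\<forall>\<tau>\<in>set ts. \<exists>A\<subseteq>{0, 1, 2}. card A \<le> (if \<tau> \<in> Q then 2 else 3) \<and> (\<forall>c\<in>P. c \<tau> \<in> A)"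
  proof
    fix \<tau> assume \<tau>: "\<tau> \<in> set ts"
    show "\<exists>A\<subseteq>{0, 1, 2}. card A \<le> (if \<tau> \<in> Q then 2 else 3) \<and> (\<forall>c\<in>P. c \<tau> \<in> A)"
    proof (cases "\<tau> \<in> Q")
      case False
      then show ?thesis using P \<tau> by (intro exI[of _ "{0, 1, 2}"]) (auto dest!: subsetD PiE_mem)
    qed (use Q[OF \<tau>] in simp)
  qed
  then obtain A where A: "\<And>\<tau>. \<tau> \<in> set ts \<Longrightarrow> A \<tau> \<subseteq> {0, 1, 2}"
    "\<And>\<tau>. \<tau> \<in> set ts \<Longrightarrow> card (A \<tau>) \<le> (if \<tau> \<in> Q then 2 else 3)"
    "\<And>\<tau> c. \<tau> \<in> set ts \<Longrightarrow> c \<in> P \<Longrightarrow> c \<tau> \<in> A \<tau>"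
    by metis
  have finA: "finite (A \<tau>)" if "\<tau> \<in> set ts" for \<tau> using A(1)[OF that] finite_subset by blast
  have "P \<subseteq> PiE (set ts) A" using P A(3) by (auto simp: PiE_iff)
  then have "card P \<le> card (PiE (set ts) A)"
    using finA by (intro card_mono finite_PiE) auto
  then have "real (card P) \<le> real (card (PiE (set ts) A))" by (rule of_nat_mono)
  also have "\<dots> = (\<Prod>\<tau>\<in>set ts. real (card (A \<tau>)))" by (simp add: card_PiE)
  also have "\<dots> \<le> (\<Prod>\<tau>\<in>set ts. 3 * (if \<tau> \<in> Q then 2 / 3 else 1))"
  proof (intro prod_mono conjI)
    fix \<tau> assume "\<tau> \<in> set ts"
    then show "real (card (A \<tau>)) \<le> 3 * (if \<tau> \<in> Q then 2 / 3 else 1)"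
      using A(2)[of \<tau>] by (auto split: if_splits)
  qed simp
  also have "\<dots> = 3 ^ length ts * (\<Prod>\<tau>\<in>set ts. if \<tau> \<in> Q then 2 / 3 else 1)"
    using ts by (simp add: prod.distrib distinct_card)
  also have "(\<Prod>\<tau>\<in>set ts. if \<tau> \<in> Q then 2 / 3 else (1 :: real)) =
      prod_list (map (\<lambda>\<tau>. if \<tau> \<in> Q then 2 / 3 else 1) ts)"
    by (rule prod.distinct_set_conv_list[OF ts])
  finally show ?thesis .
qed

lemma mix_PiE: "X \<in> I \<rightarrow>\<^sub>E S \<Longrightarrow> X' \<in> I \<rightarrow>\<^sub>E S \<Longrightarrow> mix Y X X' \<in> I \<rightarrow>\<^sub>E S"
  by (auto simp: mix_def PiE_iff extensional_def)

text \<open>If \<open>g h\<close> is large at two points of a rectangle, then the identity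
  \<open>(g h)(X) (g h)(X') = (g h)(mix X X') (g h)(mix X' X)\<close> keeps it away from \<open>0\<close> at the mixed
  points, so these lie in the support of the limit.\<close>

lemma (in boolean_dc_spn) rectangle_cover:
  fixes \<delta> :: real
  assumes n: "3 < n" and s: "circuit_size \<Phi> \<le> s"
    and T: "T \<subseteq> {1..n} \<rightarrow>\<^sub>E {0, 1}" and \<delta>: "0 < \<delta>"
    and approx: "\<forall>x\<in>{1..n} \<rightarrow>\<^sub>E {0, 1}.
      \<bar>spn_output f \<Phi> x - (if x \<in> T then \<delta> else 0)\<bar> < \<delta> / (16 * real s ^ 2)"
  shows "\<exists>(B :: 'a set) Y R. finite B \<and> card B \<le> s \<and>
    (\<forall>u\<in>B. Y u \<subseteq> {1..n} \<and> n \<le> 3 * card (Y u) \<and> 3 * card (Y u) \<le> 2 * n \<and>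
       (\<forall>X\<in>R u. \<forall>X'\<in>R u. mix (Y u) X X' \<in> T)) \<and>
    T \<subseteq> (\<Union>u\<in>B. R u)"
proof -
  note approx = bspec[OF approx]
  have "0 < circuit_size \<Phi>"
    unfolding circuit_size_def using root_in_nodes finite_nodes by (auto simp: card_gt_0_iff)
  then have s1: "1 \<le> real s" using s by linarith
  \<comment> \<open>With \<open>K = \<delta>^2 / s^2\<close>, two points of a rectangle have values
    with product at least \<open>225/256 * K\<close>, whereas a mixed point outside \<open>T\<close>
    would bound it by \<open>\<epsilon> * (\<delta> + \<epsilon>) \<le> 17/256 * K\<close>.\<close>
  define \<epsilon> where "\<epsilon> = \<delta> / (16 * real s ^ 2)"
  have \<epsilon>: "0 < \<epsilon>" "\<epsilon> \<le> \<delta> / 16"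
  proof -
    have "1 \<le> real s ^ 2" using s1 by simp
    then show "0 < \<epsilon>" "\<epsilon> \<le> \<delta> / 16"
      unfolding \<epsilon>_def using \<delta> s1 divide_left_mono[of 16 "16 * real s ^ 2" \<delta>] by simp_all
  qed
  from balanced_product_cover[OF n] obtain B :: "'a set" and Y g h
    where B: "finite B" "card B \<le> circuit_size \<Phi>"
    and Y': "\<forall>u\<in>B. Y u \<subseteq> {1..n} \<and> n \<le> 3 * card (Y u) \<and> 3 * card (Y u) \<le> 2 * n \<and>
       depends_on (g u) (Y u) \<and> depends_on (h u) ({1..n} - Y u)"
    and gh': "\<forall>x\<in>cube. (\<forall>u\<in>B. 0 \<le> g u x \<and> 0 \<le> h u x \<and> g u x * h u x \<le> spn_output f \<Phi> x) \<and>
       spn_output f \<Phi> x \<le> (\<Sum>u\<in>B. g u x * h u x)"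
    by (elim exE conjE)
  note Y = bspec[OF Y']
  have gh: "0 \<le> g u x \<and> 0 \<le> h u x \<and> g u x * h u x \<le> spn_output f \<Phi> x"
    if "x \<in> cube" "u \<in> B" for u x using gh' that by simp
  have total: "spn_output f \<Phi> x \<le> (\<Sum>u\<in>B. g u x * h u x)" if "x \<in> cube" for x
    using gh' that by simp
  have cube: "x \<in> cube" if "x \<in> {1..n} \<rightarrow>\<^sub>E {0, 1}" for x
    using that by (auto simp: cube_def PiE_iff)
  \<comment> \<open>The threshold comes from pigeonhole: at a point of \<open>T\<close> the output
    exceeds \<open>\<delta> - \<epsilon>\<close>, so one of at most \<open>s\<close> products
    reaches this share.\<close>
  define R where "R = (\<lambda>u. {X \<in> T. (\<delta> - \<epsilon>) / real s \<le> g u X * h u X})"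
  have mix: "mix (Y u) X X' \<in> T" if u: "u \<in> B" and X: "X \<in> R u" "X' \<in> R u" for u X X'
  proof (rule ccontr)
    define z z' where "z = mix (Y u) X X'" and "z' = mix (Y u) X' X"
    define K where "K = \<delta> * \<delta> / real s ^ 2"
    assume "\<not> ?thesis"
    then have zT: "z \<notin> T" by (simp add: z_def)
    have XE: "X \<in> {1..n} \<rightarrow>\<^sub>E {0, 1}" "X' \<in> {1..n} \<rightarrow>\<^sub>E {0, 1}"
      using X T by (auto simp: R_def)
    have zE: "z \<in> {1..n} \<rightarrow>\<^sub>E {0, 1}" "z' \<in> {1..n} \<rightarrow>\<^sub>E {0, 1}"
      unfolding z_def z'_def by (rule mix_PiE[OF XE] mix_PiE[OF XE(2,1)])+
    have g: "g u z = g u X" "g u z' = g u X'"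
      using Y[OF u] unfolding depends_on_def z_def z'_def mix_def by simp_all
    have h: "h u z = h u X'" "h u z' = h u X"
      using Y[OF u] unfolding depends_on_def z_def z'_def mix_def by simp_all
    have "((\<delta> - \<epsilon>) / real s) * ((\<delta> - \<epsilon>) / real s) \<le> (g u X * h u X) * (g u X' * h u X')"
      using X \<epsilon> \<delta> s1 gh[OF cube[OF XE(1)] u] by (intro mult_mono) (auto simp: R_def)
    also have "\<dots> = (g u z * h u z) * (g u z' * h u z')" by (simp add: g h mult_ac)
    also have "\<dots> \<le> \<epsilon> * (\<delta> + \<epsilon>)"
    proof (intro mult_mono)
      have "\<bar>spn_output f \<Phi> z\<bar> < \<epsilon>" using approx[OF zE(1)] zT by (simp add: \<epsilon>_def)
      then show "g u z * h u z \<le> \<epsilon>" using gh[OF cube[OF zE(1)] u] by linarith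
      have "spn_output f \<Phi> z' \<le> \<delta> + \<epsilon>"
        using approx[OF zE(2)] \<delta> by (auto simp: \<epsilon>_def split: if_splits)
      then show "g u z' * h u z' \<le> \<delta> + \<epsilon>"
        using gh[OF cube[OF zE(2)] u] by simp
    qed (use \<epsilon> gh[OF cube[OF zE(2)] u] in auto)
    also have "\<dots> \<le> \<epsilon> * (17 / 16 * \<delta>)" using \<epsilon> by (intro mult_left_mono) auto
    also have "\<dots> = 17 / 256 * K" by (simp add: \<epsilon>_def K_def)
    finally have le: "((\<delta> - \<epsilon>) / real s) * ((\<delta> - \<epsilon>) / real s) \<le> 17 / 256 * K" .
    have "225 / 256 * K = (15 / 16 * \<delta> / real s) * (15 / 16 * \<delta> / real s)"
      by (simp add: K_def power2_eq_square)
    also have "\<dots> \<le> ((\<delta> - \<epsilon>) / real s) * ((\<delta> - \<epsilon>) / real s)"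
      using \<epsilon> \<delta> s1 by (intro mult_mono divide_right_mono) auto
    also have "\<dots> \<le> 17 / 256 * K" by (rule le)
    finally have "225 / 256 * K \<le> 17 / 256 * K" .
    moreover have "0 < K" unfolding K_def using \<delta> s1 by simp
    ultimately show False by linarith
  qed
  have cover: "X \<in> (\<Union>u\<in>B. R u)" if X: "X \<in> T" for X
  proof (rule ccontr)
    assume "X \<notin> (\<Union>u\<in>B. R u)"
    then have "g u X * h u X \<le> (\<delta> - \<epsilon>) / real s" if "u \<in> B" for u
      using that X by (auto simp: R_def not_le)
    then have "(\<Sum>u\<in>B. g u X * h u X) \<le> real (card B) * ((\<delta> - \<epsilon>) / real s)"
      by (rule sum_bounded_above)
    also have "\<dots> \<le> real s * ((\<delta> - \<epsilon>) / real s)"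
      using B(2) s \<epsilon> \<delta> by (intro mult_right_mono) auto
    also have "\<dots> = \<delta> - \<epsilon>" using s1 by simp
    finally have "spn_output f \<Phi> X \<le> \<delta> - \<epsilon>"
      using total[OF cube[OF subsetD[OF T X]]] by linarith
    moreover have "\<bar>spn_output f \<Phi> X - \<delta>\<bar> < \<epsilon>"
      using approx[OF subsetD[OF T X]] X by (simp add: \<epsilon>_def)
    ultimately show False by linarith
  qed
  show ?thesis
  proof (intro exI conjI ballI)
    show "finite B" "card B \<le> s" using B s by simp_all
    show "T \<subseteq> (\<Union>u\<in>B. R u)" using cover by (rule subsetI)
    fix u assume u: "u \<in> B"
    show "Y u \<subseteq> {1..n}" "n \<le> 3 * card (Y u)" "3 * card (Y u) \<le> 2 * n"
      using Y[OF u] by simp_all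
    show "mix (Y u) X X' \<in> T" if "X \<in> R u" "X' \<in> R u" for X X'
      using mix[OF u that] .
  qed
qed

section \<open>Counting patterns covered by balanced rectangles\<close>

definition arcs_of :: "(nat \<Rightarrow> nat set) \<Rightarrow> nat set \<Rightarrow> (nat \<times> nat) set" where
  "arcs_of e I = {(a, b). {a, b} \<in> e ` I}"

text \<open>Both orientations of each edge count, and they are distinct since edges are not loops.
  With \<open>m * (m - 1) = 2 * n\<close> this turns a third of the edges into a third of the
  arcs.\<close>

lemma card_arcs_of:
  assumes e: "bij_betw e {1..n} (undirected_edges (complete_pair_graph m))" and I: "I \<subseteq> {1..n}"
  shows "2 * card I \<le> card (arcs_of e I)" and "arcs_of e I \<subseteq> {1..m} \<times> {1..m}"
    and "irrefl (arcs_of e I)"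
proof -
  have E: "\<exists>a b. e i = {a, b} \<and> a \<noteq> b \<and> a \<in> {1..m} \<and> b \<in> {1..m}" if "i \<in> I" for i
  proof -
    have "e i \<in> undirected_edges (complete_pair_graph m)" using bij_betwE[OF e] I that by blast
    then show ?thesis unfolding undirected_edges_complete by auto
  qed
  have ab: "a \<noteq> b \<and> a \<in> {1..m} \<and> b \<in> {1..m}" if "(a, b) \<in> arcs_of e I" for a b
    using that E by (fastforce simp: arcs_of_def doubleton_eq_iff)
  show sub: "arcs_of e I \<subseteq> {1..m} \<times> {1..m}" using ab by auto
  show "irrefl (arcs_of e I)" using ab by (auto simp: irrefl_def)
  from E obtain a b where e_eq: "\<And>i. i \<in> I \<Longrightarrow> e i = {a i, b i}" "\<And>i. i \<in> I \<Longrightarrow> a i \<noteq> b i"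
    by metis
  define \<phi> where "\<phi> = (\<lambda>(i, flip). if flip then (b i, a i) else (a i, b i))"
  have "inj_on \<phi> (I \<times> (UNIV :: bool set))"
  proof (rule inj_onI, clarify)
    fix i j p q assume *: "i \<in> I" "j \<in> I" "\<phi> (i, p) = \<phi> (j, q)"
    then have "{a i, b i} = {a j, b j}" by (auto simp: \<phi>_def split: if_splits)
    then have "e i = e j" using * by (simp add: e_eq)
    then have "i = j" using bij_betw_imp_inj_on[OF e] I * by (auto dest: inj_onD)
    then show "i = j \<and> p = q" using * e_eq(2) by (auto simp: \<phi>_def split: if_splits)
  qed
  moreover have "\<phi> ` (I \<times> UNIV) \<subseteq> arcs_of e I"
    using e_eq by (force simp: \<phi>_def arcs_of_def insert_commute)
  moreover have "finite (arcs_of e I)" using sub finite_subset by blast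
  ultimately have "card (I \<times> (UNIV :: bool set)) \<le> card (arcs_of e I)"
    by (rule card_inj_on_le)
  then show "2 * card I \<le> card (arcs_of e I)" by (simp add: card_cartesian_product)
qed

lemma triples_nonempty:
  assumes "3 \<le> card V" shows "triples V \<noteq> {}"
proof -
  obtain S where "S \<subseteq> V" "card S = 3" using obtain_subset_with_card_n[OF assms] by metis
  then obtain x y z where "{x, y, z} \<subseteq> V" "x \<noteq> y" "y \<noteq> z" "x \<noteq> z" by (auto simp: card_3_iff)
  then have "(x, y, z) \<in> triples V" by (auto simp: triples_def)
  then show ?thesis by blast
qed

text \<open>On \<open>t\<close> greedily chosen triples there are \<open>3 ^ t\<close> patterns,
  each giving a spanning tree. The rectangles together cover at most
  \<open>3 ^ t * card B * (149 / 150) ^ t\<close> of them, yet they cover all.\<close>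

lemma rectangle_cover_lower_bound:
  assumes m: "20 \<le> m" and n: "n = m choose 2"
    and e: "bij_betw e {1..n} (undirected_edges (complete_pair_graph m))"
    and B: "finite B"
    and Y: "\<And>u. u \<in> B \<Longrightarrow> Y u \<subseteq> {1..n} \<and> n \<le> 3 * card (Y u) \<and> 3 * card (Y u) \<le> 2 * n"
    and R: "\<And>u. u \<in> B \<Longrightarrow> \<forall>X\<in>R u. \<forall>X'\<in>R u. mix (Y u) X X' \<in> spanning_tree_vectors m n e"
    and cover: "spanning_tree_vectors m n e \<subseteq> (\<Union>u\<in>B. R u)"
  shows "1 \<le> real (card B) * (149 / 150) ^ (m div 200 + 1)"
proof -
  \<comment> \<open>Linear in \<open>m\<close>, yet small enough that \<open>3 * (t - 1)\<close>
    used vertices preserve the density of mixed triples and that \<open>3 * t < m\<close> leaves a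
    vertex for the centre \<open>w\<close>.\<close>
  define t where "t = m div 200 + 1"
  have n2: "m * (m - 1) = 2 * n"
  proof -
    have "even (m * (m - 1))" using m by auto
    then show ?thesis using n by (simp add: choose_two)
  qed
  define red where "red = (\<lambda>u. arcs_of e (Y u))"
  define blue where "blue = (\<lambda>u. arcs_of e ({1..n} - Y u))"
  define Q where "Q = (\<lambda>u. {(x, y, z). (x, y) \<in> red u \<and> (y, z) \<in> blue u})"
  have card_V': "3 \<le> card V'" if "V' \<subseteq> {1..m}" "card ({1..m} - V') \<le> 3 * (t - 1)" for V'
  proof -
    have "card ({1..m} - V') = m - card V'"
      using that(1) card_Diff_subset[of V' "{1..m}"] finite_subset by fastforce
    then show ?thesis using that(2) m by (auto simp: t_def)
  qed
  have dense: "card (triples V') \<le> 50 * card (triples V' \<inter> Q u)"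
    if V': "V' \<subseteq> {1..m}" "card ({1..m} - V') \<le> 3 * (t - 1)" and u: "u \<in> B" for V' u
  proof -
    have sub: "Y u \<subseteq> {1..n}" "{1..n} - Y u \<subseteq> {1..n}" using Y[OF u] by auto
    have card_compl: "card ({1..n} - Y u) = n - card (Y u)"
      using sub card_Diff_subset[of "Y u" "{1..n}"] finite_subset by fastforce
    note red = card_arcs_of[OF e sub(1), folded red_def[THEN fun_cong]]
    note blue = card_arcs_of[OF e sub(2), folded blue_def[THEN fun_cong]]
    have total: "(a, b) \<in> red u \<union> blue u" if "a \<in> {1..m}" "b \<in> {1..m}" "a \<noteq> b" for a b
    proof -
      have "{a, b} \<in> undirected_edges (complete_pair_graph m)"
        unfolding undirected_edges_complete using that by blast
      then have "{a, b} \<in> e ` {1..n}" using bij_betw_imp_surj_on[OF e] by simp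
      then show ?thesis by (auto simp: red_def blue_def arcs_of_def)
    qed
    have "False" if ab: "(a, b) \<in> red u" "(b, a) \<in> blue u" for a b
    proof -
      obtain i j where "i \<in> Y u" "e i = {a, b}" "j \<in> {1..n} - Y u" "e j = {a, b}"
        using ab by (force simp: red_def blue_def arcs_of_def insert_commute)
      moreover from this have "i = j"
        using sub(1) by (intro inj_onD[OF bij_betw_imp_inj_on[OF e]]) auto
      ultimately show False by simp
    qed
    then have disj: "red u \<inter> (blue u)\<inverse> = {}" by auto
    show ?thesis
      unfolding Q_def
    proof (rule many_mixed_triples[OF m V'(1) _ red(2) _ blue(2) _ red(3) blue(3) disj total])
      show "card ({1..m} - V') \<le> 3 * (m div 200)" using V'(2) by (simp add: t_def)
      show "m * (m - 1) \<le> 3 * card (red u)" using red(1) Y[OF u] n2 by linarith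
      show "m * (m - 1) \<le> 3 * card (blue u)" using blue(1) Y[OF u] n2 card_compl by linarith
    qed
  qed
  obtain ts where ts: "length ts = t" "distinct (triple_vertices ts)"
    "set (triple_vertices ts) \<subseteq> {1..m}"
    "(\<Sum>u\<in>B. prod_list (map (\<lambda>\<tau>. if \<tau> \<in> Q u then 2 / 3 else 1) ts)) \<le> real (card B) * (149 / 150) ^ t"
    using greedy_disjoint_triples[of "{1..m}" B t Q] B dense triples_nonempty[OF card_V'] by auto
  have "card (set (triple_vertices ts)) = 3 * t"
    using ts by (simp add: distinct_card length_triple_vertices)
  then have "card (set (triple_vertices ts)) < card {1..m}" using m by (auto simp: t_def)
  then have "\<not> {1..m} \<subseteq> set (triple_vertices ts)"
    using card_mono[of "set (triple_vertices ts)" "{1..m}"] by auto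
  then obtain w where w: "w \<in> {1..m}" "w \<notin> set (triple_vertices ts)" by blast
  let ?C = "set ts \<rightarrow>\<^sub>E {0, 1, 2 :: nat}"
  define P where "P = (\<lambda>u. {c \<in> ?C. tree_vector m n e w ts c \<in> R u})"
  have finC: "finite ?C" by (intro finite_PiE) auto
  have card_P: "real (card (P u)) \<le> 3 ^ t * prod_list (map (\<lambda>\<tau>. if \<tau> \<in> Q u then 2 / 3 else 1) ts)"
    if u: "u \<in> B" for u
    unfolding ts(1)[symmetric]
  proof (rule card_restricted_patterns[OF distinct_triples[OF ts(2)]])
    show "P u \<subseteq> ?C" by (auto simp: P_def)
    fix \<tau> assume \<tau>: "\<tau> \<in> set ts" "\<tau> \<in> Q u"
    obtain x y z where xyz: "\<tau> = (x, y, z)" by (cases \<tau>)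
    then obtain i j where i: "i \<in> Y u" "e i = {x, y}" and j: "j \<in> {1..n} - Y u" "e j = {y, z}"
      using \<tau>(2) by (auto simp: Q_def red_def blue_def arcs_of_def)
    have ij: "i \<in> {1..n}" "j \<in> {1..n}" "j \<notin> Y u" using i j Y[OF u] by auto
    from rectangle_restricts_pattern[where R = "R u" and Y = "Y u",
        OF e ts(2,3) w R[OF u] \<tau>(1)[unfolded xyz] ij(1) i ij(2,3) j(2)]
    obtain A where A: "A \<subseteq> {0, 1, 2}" "card A \<le> 2"
      "\<forall>c\<in>?C. tree_vector m n e w ts c \<in> R u \<longrightarrow> c (x, y, z) \<in> A"
      by (elim exE conjE)
    then have "\<forall>c\<in>P u. c \<tau> \<in> A" unfolding P_def xyz by simp
    with A(1,2) show "\<exists>A\<subseteq>{0, 1, 2}. card A \<le> 2 \<and> (\<forall>c\<in>P u. c \<tau> \<in> A)"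
      by (intro exI[of _ A] conjI)
  qed
  have "?C \<subseteq> (\<Union>u\<in>B. P u)"
  proof
    fix c assume c: "c \<in> ?C"
    have "tree_vector m n e w ts c \<in> (\<Union>u\<in>B. R u)"
      using tree_vector_spanning[OF e ts(2,3) w] cover by (rule subsetD[rotated])
    then show "c \<in> (\<Union>u\<in>B. P u)" using c unfolding P_def by blast
  qed
  then have "card ?C \<le> card (\<Union>u\<in>B. P u)"
    using B finC by (intro card_mono) (auto simp: P_def)
  also have "\<dots> \<le> (\<Sum>u\<in>B. card (P u))" by (rule card_UN_le[OF B])
  finally have "3 ^ t \<le> (\<Sum>u\<in>B. card (P u))"
    using ts(1) distinct_card[OF distinct_triples[OF ts(2)]]
    by (simp add: card_PiE numeral_3_eq_3)
  then have "real (3 ^ t) \<le> real (\<Sum>u\<in>B. card (P u))" by (rule of_nat_mono)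
  also have "\<dots> = (\<Sum>u\<in>B. real (card (P u)))" by simp
  also have "\<dots> \<le> (\<Sum>u\<in>B. 3 ^ t * prod_list (map (\<lambda>\<tau>. if \<tau> \<in> Q u then 2 / 3 else 1) ts))"
    by (intro sum_mono card_P)
  also have "\<dots> = 3 ^ t * (\<Sum>u\<in>B. prod_list (map (\<lambda>\<tau>. if \<tau> \<in> Q u then 2 / 3 else 1) ts))"
    by (simp add: sum_distrib_left)
  also have "\<dots> \<le> 3 ^ t * (real (card B) * (149 / 150) ^ t)"
    using ts(4) by (intro mult_left_mono) auto
  finally have "3 ^ t * 1 \<le> 3 ^ t * (real (card B) * (149 / 150) ^ t)" by simp
  then show ?thesis by (subst (asm) mult_le_cancel_left_pos) (auto simp: t_def)
qed

text \<open>From \<open>149 / 150 \<le> exp (- 1 / 150)\<close> and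
  \<open>m div 200 + 1 \<ge> m / 200\<close> one gets \<open>s \<ge> exp (m / 30000)\<close>, which
  is at least \<open>2 powr (m / 30240)\<close> as \<open>ln 2 < 1\<close>.\<close>

lemma numeric_bound:
  assumes "1 \<le> s * (149 / 150) ^ (m div 200 + 1)" and "0 \<le> s"
  shows "2 powr (real m / 30240) \<le> s"
proof -
  let ?t = "m div 200 + 1"
  have "200 * ?t \<ge> m" by simp
  then have "real m \<le> real (200 * ?t)" by (rule of_nat_mono)
  then have t: "real m \<le> 200 * real ?t" by simp
  have "(149 / 150 :: real) ^ ?t \<le> exp (- (1 / 150)) ^ ?t"
    using exp_ge_add_one_self[of "- (1 / 150)"] by (intro power_mono) auto
  also have "\<dots> = exp (- (real ?t / 150))" by (subst exp_of_nat_mult[symmetric]) (simp add: field_simps)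
  finally have "1 \<le> s * exp (- (real ?t / 150))"
    using assms mult_left_mono by fastforce
  then have "exp (real ?t / 150) \<le> s" by (simp add: exp_minus field_simps)
  moreover have "2 powr (real m / 30240) \<le> exp (real ?t / 150)"
  proof -
    have "real m / 30240 * ln 2 \<le> real m / 30240 * 1"
      using ln_2_less_1 by (intro mult_left_mono) auto
    also have "\<dots> \<le> real ?t / 150" using t by simp
    finally show ?thesis by (simp add: powr_def)
  qed
  ultimately show ?thesis by linarith
qed

theorem theorem37:
  fixes m n s :: nat
    and e :: "nat \<Rightarrow> nat set"
    and k :: "nat \<Rightarrow> nat \<Rightarrow> nat"
    and f :: "nat \<Rightarrow> nat \<Rightarrow> nat \<Rightarrow> real \<Rightarrow> real"
    and \<Phi> :: "nat \<Rightarrow> ('a, nat \<times> nat) circuit"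
  assumes "m \<ge> 20"
    and "n = m choose 2"
    and "bij_betw e {1..n} (undirected_edges (complete_pair_graph m))"
    and "\<And>j. j \<ge> 1 \<Longrightarrow> dc_spn n (\<lambda>_. count_space {0, 1}) (k j) (f j) (\<Phi> j)"
    and "\<And>j. j \<ge> 1 \<Longrightarrow> circuit_size (\<Phi> j) \<le> s"
    and "\<And>x. x \<in> {1..n} \<rightarrow>\<^sub>E {0, 1} \<Longrightarrow>
           (\<lambda>j. spn_output (f j) (\<Phi> j) x) \<longlonglongrightarrow> spanning_tree_density m n e x"
  shows "real s \<ge> 2 powr (real m / 30240)"
proof -
  let ?T = "spanning_tree_vectors m n e"
  let ?D = "{1..n} \<rightarrow>\<^sub>E {0, 1 :: real}"
  have T: "?T \<subseteq> ?D" by (auto simp: spanning_tree_vectors_def)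
  have finD: "finite ?D" by (intro finite_PiE) auto
  then have finT: "finite ?T" using T finite_subset by blast
  \<comment> \<open>Without triples the construction gives the star at vertex 1, so spanning trees
    exist and the uniform distribution is meaningful.\<close>
  have "tree_vector m n e 1 [] c \<in> ?T" for c
    using assms(1) by (intro tree_vector_spanning[OF assms(3)]) auto
  then have neT: "?T \<noteq> {}" by blast
  define \<delta> where "\<delta> = 1 / real (card ?T)"
  have \<delta>: "0 < \<delta>" using finT neT by (simp add: \<delta>_def card_gt_0_iff)
  have density: "spanning_tree_density m n e x = (if x \<in> ?T then \<delta> else 0)" for x
    using finT neT by (simp add: spanning_tree_density_def \<delta>_def indicator_def)
  have n3: "3 < n"
  proof -
    have "19 * 20 \<le> (m - 1) * m" using assms(1) by (intro mult_le_mono) auto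
    then show ?thesis using assms(2) by (simp add: choose_two mult.commute)
  qed
  have s0: "0 < real s"
  proof -
    interpret boolean_dc_spn n "k 1" "f 1" "\<Phi> 1" using assms(4) by unfold_locales simp
    have "0 < circuit_size (\<Phi> 1)"
      unfolding circuit_size_def using root_in_nodes finite_nodes by (auto simp: card_gt_0_iff)
    then show ?thesis using assms(5)[of 1] by simp
  qed
  then have "0 < \<delta> / (16 * real s ^ 2)" using \<delta> by simp
  \<comment> \<open>Pointwise convergence on the finite cube is uniform, so a single circuit is
    within the tolerance of \<open>rectangle_cover\<close> at all points.\<close>
  then have "\<forall>\<^sub>F j in sequentially. \<forall>x\<in>?D.
      dist (spn_output (f j) (\<Phi> j) x) (spanning_tree_density m n e x) < \<delta> / (16 * real s ^ 2)"
    using assms(6) finD by (intro eventually_ball_finite ballI tendstoD) auto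
  then have "\<forall>\<^sub>F j in sequentially. 1 \<le> j \<and> (\<forall>x\<in>?D.
      dist (spn_output (f j) (\<Phi> j) x) (spanning_tree_density m n e x) < \<delta> / (16 * real s ^ 2))"
    using eventually_ge_at_top[of 1] by eventually_elim auto
  then obtain j where j: "1 \<le> j" "\<forall>x\<in>?D.
      \<bar>spn_output (f j) (\<Phi> j) x - (if x \<in> ?T then \<delta> else 0)\<bar> < \<delta> / (16 * real s ^ 2)"
    unfolding density dist_real_def by (auto dest!: eventually_happens)
  interpret boolean_dc_spn n "k j" "f j" "\<Phi> j" using assms(4)[OF j(1)] by unfold_locales
  from rectangle_cover[OF n3 assms(5)[OF j(1)] T \<delta> j(2)] obtain B :: "'a set" and Y R
    where B: "finite B" "card B \<le> s" and
      Y: "\<forall>u\<in>B. Y u \<subseteq> {1..n} \<and> n \<le> 3 * card (Y u) \<and> 3 * card (Y u) \<le> 2 * n \<and>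
        (\<forall>X\<in>R u. \<forall>X'\<in>R u. mix (Y u) X X' \<in> ?T)" and
      cover: "?T \<subseteq> (\<Union>u\<in>B. R u)"
    by (elim exE conjE)
  have "1 \<le> real (card B) * (149 / 150) ^ (m div 200 + 1)"
    by (rule rectangle_cover_lower_bound[where Y = Y, OF assms(1-3) B(1) _ _ cover]) (use Y in auto)
  then have "2 powr (real m / 30240) \<le> real (card B)" by (rule numeric_bound) simp
  also have "\<dots> \<le> real s" using B(2) by simp
  finally show ?thesis .
qed

end
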